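(* Let $G$ be a graph with $n\geq 6$ vertices which is not isomorphic to the $r$-partite Tur\'an graph $T(2r,r)$ for any $r$. Then $$\chi_{\mathrm{gb}}(G)-\chi(G)\leq\lfloor n/2\rfloor-2.$$
   Context: All graphs are finite and simple, but not necessarily connected. $\chi(G)$ is the usual chromatic number. $T(2r,r)$ is the complete $r$-partite graph on $2r$ vertices with all $r$ parts of size $2$. The vertex colouring game with blanks on $G$ with $k$ colours: two players, Maker and Breaker, move alternately, Maker first. On each turn the player chooses an unplayed vertex and gives it one of the $k$ colours, where a colour may not be given to a vertex having a neighbour already given that colour. Breaker (but not Maker) may instead use his turn to mark any unplayed vertex as "blank". A blank is not counted as a colour and does not restrict what may be played at adjacent vertices (so playing a blank is equivalent to deleting the vertex from the graph). A vertex is played once it has been given a colour or a blank, and it is not played again. The game ends when no unplayed vertex can legally be given any (non-blank) colour; in particular, if Breaker's only legal moves are to play blanks, then the game ends and Breaker wins. Maker wins if, when the game ends, every vertex has been played; otherwise Breaker wins. $\chi_{\mathrm{gb}}(G)$ denotes the minimum number $k$ of colours (not counting blanks) for which Maker has a winning strategy in the vertex colouring game with blanks on $G$. *)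

theory Defs
  imports Complex_Main "Graph_Theory.Graph_Theory"
begin

text \<open>
  Finite simple graphs are the \<^locale>\<open>pair_graph\<close>s of Graph_Theory: a finite vertex set with a
  symmetric, loop-free arc relation, each edge being represented by its two orientations.
\<close>

definition proper_colouring :: "'a pair_pre_digraph \<Rightarrow> nat \<Rightarrow> ('a \<Rightarrow> nat) \<Rightarrow> bool" where
  "proper_colouring G k f \<longleftrightarrow>
     (\<forall>v\<in>pverts G. f v < k) \<and> (\<forall>(u, v)\<in>parcs G. f u \<noteq> f v)"

definition chromatic_number :: "'a pair_pre_digraph \<Rightarrow> nat" where
  "chromatic_number G = (LEAST k. \<exists>f. proper_colouring G k f)"

text \<open>\<open>turan_2r r\<close> is $T(2r,r)$; its parts are \<open>{i} \<times> UNIV\<close> for \<open>i < r\<close>.\<close>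

definition turan_2r :: "nat \<Rightarrow> (nat \<times> bool) pair_pre_digraph" where
  "turan_2r r = \<lparr> pverts = {..<r} \<times> UNIV,
                  parcs = {(u, v). u \<in> {..<r} \<times> UNIV \<and> v \<in> {..<r} \<times> UNIV \<and> fst u \<noteq> fst v} \<rparr>"

datatype mark = Colour nat | Blank

text \<open>
  A history is the list of moves made so far, latest move first. Read as an association list, it is
  also the current position: \<open>map_of h v\<close> is the mark on \<open>v\<close>, or \<open>None\<close> if \<open>v\<close> is unplayed.
  Since Maker starts, it is Maker's turn exactly when the length of the history is even.
\<close>

type_synonym 'a history = "('a \<times> mark) list"

definition unplayed :: "'a pair_pre_digraph \<Rightarrow> 'a history \<Rightarrow> 'a set" where
  "unplayed G h = {v \<in> pverts G. map_of h v = None}"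

definition legal_colour :: "'a pair_pre_digraph \<Rightarrow> nat \<Rightarrow> 'a history \<Rightarrow> 'a \<Rightarrow> nat \<Rightarrow> bool" where
  "legal_colour G k h v c \<longleftrightarrow>
     v \<in> unplayed G h \<and> c < k \<and> (\<forall>u. (v, u) \<in> parcs G \<longrightarrow> map_of h u \<noteq> Some (Colour c))"

definition game_over :: "'a pair_pre_digraph \<Rightarrow> nat \<Rightarrow> 'a history \<Rightarrow> bool" where
  "game_over G k h \<longleftrightarrow> \<not> (\<exists>v c. legal_colour G k h v c)"

text \<open>
  A strategy for Maker assigns to each history a vertex and a colour; only its values at Maker's
  turns matter. \<open>plays G k \<sigma>\<close> is the set of histories that can arise when Maker follows \<open>\<sigma>\<close> (and
  Breaker makes arbitrary legal moves).
\<close>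

inductive_set plays ::
    "'a pair_pre_digraph \<Rightarrow> nat \<Rightarrow> ('a history \<Rightarrow> 'a \<times> nat) \<Rightarrow> 'a history set"
  for G :: "'a pair_pre_digraph" and k :: nat and \<sigma> :: "'a history \<Rightarrow> 'a \<times> nat" where
  start: "[] \<in> plays G k \<sigma>"
| maker: "(v, Colour c) # h \<in> plays G k \<sigma>"
    if "h \<in> plays G k \<sigma>" "even (length h)" "\<sigma> h = (v, c)" "legal_colour G k h v c"
| breaker_colour: "(v, Colour c) # h \<in> plays G k \<sigma>"
    if "h \<in> plays G k \<sigma>" "odd (length h)" "legal_colour G k h v c"
| breaker_blank: "(v, Blank) # h \<in> plays G k \<sigma>"
    if "h \<in> plays G k \<sigma>" "odd (length h)" "\<not> game_over G k h" "v \<in> unplayed G h"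

definition winning_strategy ::
    "'a pair_pre_digraph \<Rightarrow> nat \<Rightarrow> ('a history \<Rightarrow> 'a \<times> nat) \<Rightarrow> bool" where
  "winning_strategy G k \<sigma> \<longleftrightarrow>
     (\<forall>h\<in>plays G k \<sigma>.
        (even (length h) \<and> \<not> game_over G k h \<longrightarrow> legal_colour G k h (fst (\<sigma> h)) (snd (\<sigma> h))) \<and>
        (game_over G k h \<longrightarrow> unplayed G h = {}))"

definition chi_gb :: "'a pair_pre_digraph \<Rightarrow> nat" where
  "chi_gb G = (LEAST k. \<exists>\<sigma>. winning_strategy G k \<sigma>)"

end

theory Submission
  imports Defs
begin

text \<open>
  Let \<open>n\<close> be the number of vertices, fix an optimal colouring \<open>f\<close> with \<open>c\<close> classes, and let
  \<open>k = c + n div 2 - 2\<close>. Only the sets of colours still legal at the unplayed vertices matter, so the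
  game is a list colouring game. Call a colour fresh if it is legal at every unplayed vertex, and
  call a class of \<open>f\<close> safe if it owns a private colour: one that is legal at all its unplayed
  vertices and that no other class relies on. When Maker plays a fresh colour in an unsafe class, the
  class becomes safe; hence (number of fresh colours) - (number of unsafe classes with unplayed
  vertices) is not changed by this move. A move of Breaker lowers this balance by at most one, and only
  if he wastes a fresh colour in a safe class or spoils a class by playing its private colour in
  another class. All his other moves, blanks included, are unproductive
  (\<open>breaker_move_cases\<close>). The balance starts at \<open>n div 2 - 2\<close>, Breaker has \<open>n div 2\<close> moves, and Maker
  wins as long as the balance can be kept nonnegative. So Maker has to force two unproductive moves.

  One of them comes from parity. For even \<open>n\<close> Breaker's last move, on the last vertex, cannot hurt. For
  odd \<open>n\<close> Maker can ensure that on Breaker's turns every safe class has an even number of unplayed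
  vertices (\<open>wins_if_safe_classes_even\<close>). The other one comes from the observation that Breaker has no
  productive move when there is no safe class. Maker therefore plays all the vertices of one class
  first, with one colour (\<open>fresh_win_by_exhausting\<close>). If all moves of Breaker are productive, then
  either Maker takes the last vertex of the class and Breaker is to move without a safe class, or
  Breaker takes it, or he spoils the class. In the last two cases there is no safe class either, but it
  is Maker's turn; the position is one of the same kind on fewer vertices, which allows induction.
  Moreover, if Maker's colour for the exhausted or spoiled class is still legal anywhere, he plays it
  there, which brings Breaker to move without a safe class (\<open>maker_wins_by_tempo\<close>). So this
  colour may be assumed to be seen by all unplayed vertices.

  If a class is a singleton, Maker exhausts it at once. If all classes have size 2 but the graph is not
  complete multipartite, Maker starts at an end of a missing edge: if Breaker completes that class, the
  colour can be reused at the other end as a tempo move (\<open>fresh_win_pairs\<close>). In all other cases, the class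
  to exhaust is chosen so that the remaining position is won by induction, or has a singleton class, or
  consists of one class. This choice is not sufficient only for class sizes 3 and 3, for 3 and 4, and
  for 3, 3, 2, ..., 2. For 3 and 3 and for 3, 3, 2, ..., 2 it is enough to choose the first vertex
  suitably, unless all degrees are too small to matter. For 3 and 4 the same is true unless
  the graph is a cube with one vertex removed, on which Maker wins by an explicit strategy
  (\<open>fresh_win_cube_minus_vertex\<close>).
\<close>

section \<open>The game on lists of available colours\<close>

text \<open>
  The colouring \<open>f\<close> is only a device for the analysis. It is fixed throughout, while the set of unplayed
  vertices shrinks.
\<close>

locale coloured_graph =
  fixes adj :: "'a \<Rightarrow> 'a \<Rightarrow> bool" and f :: "'a \<Rightarrow> nat"
  assumes adj_sym: "adj u v \<Longrightarrow> adj v u"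
    and proper: "adj u v \<Longrightarrow> f u \<noteq> f v"
begin

text \<open>
  \<open>L w\<close> is the set of colours that may still be given to \<open>w\<close>; this updates it when \<open>v\<close> receives \<open>c\<close>.
\<close>

definition play :: "'a \<Rightarrow> nat \<Rightarrow> ('a \<Rightarrow> nat set) \<Rightarrow> 'a \<Rightarrow> nat set" where
  "play v c L = (\<lambda>w. if adj v w then L w - {c} else L w)"

text \<open>
  Both predicates say that Maker wins from a position with unplayed set \<open>U\<close>; they differ in whose turn
  it is. The first premise of \<open>breaker_move\<close> excludes positions in which the game is over with vertices
  unplayed, in particular those in which Breaker could only play blanks.
\<close>

inductive maker_wins :: "'a set \<Rightarrow> ('a \<Rightarrow> nat set) \<Rightarrow> bool"
  and breaker_loses :: "'a set \<Rightarrow> ('a \<Rightarrow> nat set) \<Rightarrow> bool" where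
  maker_done: "maker_wins {} L"
| maker_move: "maker_wins U L"
    if "v \<in> U" "c \<in> L v" "breaker_loses (U - {v}) (play v c L)"
| breaker_done: "breaker_loses {} L"
| breaker_move: "breaker_loses U L"
    if "\<exists>v\<in>U. L v \<noteq> {}"
      "\<And>v c. v \<in> U \<Longrightarrow> c \<in> L v \<Longrightarrow> maker_wins (U - {v}) (play v c L)"
      "\<And>v. v \<in> U \<Longrightarrow> maker_wins (U - {v}) L"

section \<open>Fresh and private colours\<close>

definition cls :: "'a set \<Rightarrow> nat \<Rightarrow> 'a set" where
  "cls U i = {v \<in> U. f v = i}"

text \<open>
  A class is safe if it has a private colour, given by the partial map \<open>P\<close>. Only classes with unplayed
  vertices are counted as unsafe.
\<close>

definition unsafe :: "'a set \<Rightarrow> (nat \<Rightarrow> nat option) \<Rightarrow> nat set" where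
  "unsafe U P = f ` U - dom P"

text \<open>
  The set \<open>F\<close> consists of fresh colours, but need not contain all of them, and \<open>P\<close> need not mention all
  possible private colours. Forgetting a private colour is how a spoiled class is treated.
\<close>

definition stage ::
    "'a set \<Rightarrow> ('a \<Rightarrow> nat set) \<Rightarrow> nat set \<Rightarrow> (nat \<Rightarrow> nat option) \<Rightarrow> bool" where
  "stage U L F P \<longleftrightarrow> finite U \<and> finite F \<and> (\<forall>v\<in>U. \<forall>c\<in>F. c \<in> L v)
     \<and> (\<forall>v\<in>U. \<forall>c. P (f v) = Some c \<longrightarrow> c \<in> L v)
     \<and> (\<forall>i j c. P i = Some c \<longrightarrow> P j = Some c \<longrightarrow> i = j) \<and> ran P \<inter> F = {}"

lemma stage_finite: "stage U L F P \<Longrightarrow> finite U" "stage U L F P \<Longrightarrow> finite F"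
  by (simp_all add: stage_def)

lemma stage_fresh_available: "stage U L F P \<Longrightarrow> v \<in> U \<Longrightarrow> c \<in> F \<Longrightarrow> c \<in> L v"
  by (simp add: stage_def)

lemma stage_private_available: "stage U L F P \<Longrightarrow> v \<in> U \<Longrightarrow> P (f v) = Some c \<Longrightarrow> c \<in> L v"
  unfolding stage_def by blast

lemma stage_private_not_fresh: "stage U L F P \<Longrightarrow> P i = Some c \<Longrightarrow> c \<notin> F"
  unfolding stage_def ran_def by blast

lemma in_play: "d \<in> play v c L w \<longleftrightarrow> d \<in> L w \<and> (adj v w \<longrightarrow> d \<noteq> c)"
  by (auto simp: play_def)

lemma finite_unsafe: "finite U \<Longrightarrow> finite (unsafe U P)"
  by (simp add: unsafe_def)

lemma unsafe_mono: "U \<subseteq> U' \<Longrightarrow> unsafe U P \<subseteq> unsafe U' P"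
  by (auto simp: unsafe_def)

lemma card_unsafe_remove: "finite U \<Longrightarrow> card (unsafe (U - {v}) P) \<le> card (unsafe U P)"
  by (intro card_mono finite_unsafe unsafe_mono) auto

lemma stage_fresh:
  assumes "stage U L F P" "c \<in> F"
  shows "stage (U - {v}) (play v c L) (F - {c}) P"
  using assms unfolding stage_def
  by (auto simp: in_play ran_def)

lemma stage_touch:
  assumes "stage U L F P" "c \<in> F" "f v \<notin> dom P"
  shows "stage (U - {v}) (play v c L) (F - {c}) (P(f v \<mapsto> c))"
proof -
  have 1: "c \<notin> ran P" using assms by (auto simp: stage_def)
  have 2: "\<forall>w\<in>U. c \<in> L w" using assms by (auto simp: stage_def)
  show ?thesis
    using assms 1 2 unfolding stage_def
    by (auto simp: in_play ran_def domIff dest: proper split: if_splits)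
qed

text \<open>
  Compensates the fresh colour spent in \<open>stage_touch\<close>: the balance of fresh colours over unsafe classes
  stays the same.
\<close>

lemma card_unsafe_touch:
  assumes "finite U" "v \<in> U" "f v \<notin> dom P"
  shows "card (unsafe (U - {v}) (P(f v \<mapsto> c))) + 1 \<le> card (unsafe U P)"
proof -
  have "unsafe (U - {v}) (P(f v \<mapsto> c)) \<subset> unsafe U P"
    using assms by (auto simp: unsafe_def)
  then show ?thesis using psubset_card_mono[OF finite_unsafe[OF assms(1)]] by (simp add: Suc_le_eq)
qed

text \<open>
  A private colour of a class can be played in it without any loss: the neighbours that lose it
  belong to other classes, which have different private colours.
\<close>

lemma stage_private:
  assumes "stage U L F P" "P (f v) = Some c"
  shows "stage (U - {v}) (play v c L) F P"
proof -
  have "c \<notin> F" using assms by (auto simp: stage_def ran_def)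
  then show ?thesis
    using assms unfolding stage_def
    by (auto simp: in_play dest: proper)
qed

lemma stage_spoil:
  assumes "stage U L F P" "P i = Some c"
  shows "stage (U - {v}) (play v c L) F (P(i := None))"
proof -
  have "c \<notin> F" using assms by (auto simp: stage_def ran_def)
  then show ?thesis
    using assms unfolding stage_def
    by (auto simp: in_play ran_def  split: if_splits)
qed

lemma card_unsafe_spoil:
  assumes "finite U"
  shows "card (unsafe (U - {v}) (P(i := None))) \<le> card (unsafe U P) + 1"
proof -
  have "card (unsafe (U - {v}) (P(i := None))) \<le> card (insert i (unsafe U P))"
    using assms by (intro card_mono) (auto simp: unsafe_def)
  also have "\<dots> \<le> card (unsafe U P) + 1"
    using assms finite_unsafe by (simp add: card_insert_if)
  finally show ?thesis .
qed

lemma stage_other: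
  assumes "stage U L F P" "c \<notin> F" "c \<notin> ran P"
  shows "stage (U - {v}) (play v c L) F P"
  using assms unfolding stage_def
  by (auto simp: in_play ran_def)

lemma stage_blank: "stage U L F P \<Longrightarrow> stage (U - {v}) L F P"
  by (auto simp: stage_def)

lemma stage_drop: "stage U L F P \<Longrightarrow> stage U L F Map.empty"
  by (auto simp: stage_def)

text \<open>
  The classification of Breaker's colour moves on which all counting rests. In the case \<open>fail\<close> the
  balance does not decrease, and at most the class just played becomes safe. In the cases \<open>waste\<close> and
  \<open>spoil\<close> it decreases by one, and each of them requires a safe class: the one played in, or another one.
\<close>

lemma breaker_move_cases:
  assumes st: "stage U L F P" and v: "v \<in> U"
  obtains
    (fail) F' P' where "stage (U - {v}) (play v c L) F' P'"
      "card F + card (unsafe (U - {v}) P') \<le> card F' + card (unsafe U P)"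
      "dom P' \<subseteq> insert (f v) (dom P)"
  | (waste) "c \<in> F" "f v \<in> dom P" "stage (U - {v}) (play v c L) (F - {c}) P"
  | (spoil) i where "P i = Some c" "i \<noteq> f v" "stage (U - {v}) (play v c L) F (P(i := None))"
proof -
  have fin: "finite U" "finite F" using st by (auto simp: stage_def)
  consider "c \<in> F" "f v \<in> dom P" | "c \<in> F" "f v \<notin> dom P"
    | "c \<notin> F" "c \<notin> ran P" | "P (f v) = Some c" | i where "P i = Some c" "i \<noteq> f v"
    by (auto simp: ran_def)
  then show thesis
  proof cases
    case 1
    then show thesis using waste stage_fresh[OF st] by blast
  next
    case 2
    have "card F = card (F - {c}) + 1" using 2 fin
      by (metis Suc_eq_plus1 card.remove)
    with card_unsafe_touch[OF fin(1) v 2(2), of c] show thesis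
      by (intro fail[OF stage_touch[OF st 2]]) auto
  next
    case 3
    show thesis
      by (rule fail[OF stage_other[OF st 3]]) (use card_unsafe_remove[OF fin(1)] in auto)
  next
    case 4
    show thesis
      by (rule fail[OF stage_private[OF st 4]]) (use card_unsafe_remove[OF fin(1)] in auto)
  next
    case 5
    then show thesis using spoil stage_spoil[OF st] by blast
  qed
qed

lemma stage_has_move:
  assumes "stage U L F P" "v \<in> U" "F \<noteq> {} \<or> f v \<in> dom P"
  shows "L v \<noteq> {}"
  using assms by (fastforce simp: stage_def)

lemma maker_touch:
  assumes st: "stage U L F P" and v: "v \<in> U" "f v \<notin> dom P" and F: "F \<noteq> {}"
  obtains c where "c \<in> L v" "stage (U - {v}) (play v c L) (F - {c}) (P(f v \<mapsto> c))"
    "card F = card (F - {c}) + 1"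
    "card (unsafe (U - {v}) (P(f v \<mapsto> c))) + 1 \<le> card (unsafe U P)"
proof -
  have fin: "finite U" "finite F" using st by (auto simp: stage_def)
  obtain c where c: "c \<in> F" using F by auto
  show thesis
  proof (rule that[of c])
    show "c \<in> L v" using st v c by (auto simp: stage_def)
    show "card F = card (F - {c}) + 1" using c fin
      by (metis Suc_eq_plus1 card.remove)
  qed (use stage_touch[OF st c v(2)] card_unsafe_touch[OF fin(1) v] in auto)
qed

section \<open>Forcing one unproductive move\<close>

text \<open>
  Maker touches unsafe classes while there are any. The balance drops by at most one for each move
  of Breaker, and a move that takes the last vertex is harmless; so the bounds count Breaker's
  moves with at least one vertex left afterwards.
\<close>

lemma wins_with_ample_fresh_colours:
  assumes "stage U L F P"
  shows "card (unsafe U P) + card U div 2 \<le> card F \<Longrightarrow> breaker_loses U L"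
    and "card (unsafe U P) + (card U - 1) div 2 \<le> card F \<Longrightarrow> maker_wins U L"
  using assms
proof (induction "card U" arbitrary: U L F P rule: less_induct)
  case less
  {
    case 1
    note st = 1(2)
    have fin: "finite U" "finite F" using st by (auto simp: stage_def)
    show ?case
    proof (cases "U = {}")
      case True then show ?thesis by (simp add: breaker_done)
    next
      case False
      then obtain v0 where v0: "v0 \<in> U" by auto
      have sm: "card (U - {v}) < card U" "card (U - {v}) = card U - 1" if "v \<in> U" for v
        using that fin card_Diff1_less[of U v] by auto
      show ?thesis
      proof (rule breaker_move)
        have "F \<noteq> {} \<or> f v0 \<in> dom P"
        proof (rule ccontr)
          assume "\<not> ?thesis"
          then have "f v0 \<in> unsafe U P" "card F = 0" using v0 by (auto simp: unsafe_def)
          then show False using 1(1) finite_unsafe[OF fin(1), of P] by auto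
        qed
        then show "\<exists>v\<in>U. L v \<noteq> {}" using stage_has_move[OF st v0] v0 by blast
      next
        fix v c assume v: "v \<in> U" and "c \<in> L v"
        have empty: "maker_wins (U - {v}) L'" if "card U \<le> 1" for L'
        proof -
          have "U - {v} = {}" using that v fin by (auto simp: card_le_Suc0_iff_eq)
          then show ?thesis by (simp only: maker_done)
        qed
        have arith: "card F' \<ge> s' + (card U - 1 - 1) div 2"
          if "card F + s' \<le> card F' + card (unsafe U P) + 1" "2 \<le> card U" for F' :: "nat set" and s'
          using that 1(1) by linarith
        have step: "maker_wins (U - {v}) (play v c L)"
          if "stage (U - {v}) (play v c L) F' P'"
            "card F + card (unsafe (U - {v}) P') \<le> card F' + card (unsafe U P) + 1" for F' P'
        proof (cases "card U \<le> 1")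
          case False
          show ?thesis
            by (rule less.hyps(2)[OF sm(1)[OF v] _ that(1)])
              (use arith[OF that(2)] False sm(2)[OF v] in auto)
        qed (rule empty)
        from st v show "maker_wins (U - {v}) (play v c L)"
        proof (cases rule: breaker_move_cases[where c = c])
          case (fail F' P')
          then show ?thesis by (intro step) auto
        next
          case waste
          have "card F = card (F - {c}) + 1" using waste fin
            by (metis Suc_eq_plus1 card.remove)
          then show ?thesis using card_unsafe_remove[OF fin(1), of v P]
            by (intro step[OF waste(3)]) auto
        next
          case (spoil i)
          then show ?thesis using card_unsafe_spoil[OF fin(1), of v P i]
            by (intro step[OF spoil(3)]) auto
        qed
      next
        fix v assume v: "v \<in> U"
        show "maker_wins (U - {v}) L"
          by (rule less.hyps(2)[OF sm(1)[OF v] _ stage_blank[OF st]])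
            (use 1(1) card_unsafe_remove[OF fin(1), of v P] sm(2)[OF v] in linarith)
      qed
    qed
  next
    case 2
    note st = 2(2)
    have fin: "finite U" "finite F" using st by (auto simp: stage_def)
    show ?case
    proof (cases "U = {}")
      case True then show ?thesis by (simp add: maker_done)
    next
      case False
      have sm: "card (U - {v}) < card U" "card (U - {v}) = card U - 1" if "v \<in> U" for v
        using that fin card_Diff1_less[of U v] by auto
      show ?thesis
      proof (cases "unsafe U P = {}")
        case True
        obtain v where v: "v \<in> U" using False by auto
        then obtain c where c: "P (f v) = Some c" using True by (auto simp: unsafe_def)
        have "breaker_loses (U - {v}) (play v c L)"
          by (rule less.hyps(1)[OF sm(1)[OF v] _ stage_private[OF st c]])
            (use 2(1) card_unsafe_remove[OF fin(1), of v P] sm(2)[OF v] in linarith)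
        moreover have "c \<in> L v" using st v c by (auto simp: stage_def)
        ultimately show ?thesis using v maker_move by blast
      next
        case ne: False
        then obtain v where v: "v \<in> U" "f v \<notin> dom P" by (auto simp: unsafe_def)
        have "F \<noteq> {}" using 2(1) ne finite_unsafe[OF fin(1), of P] by (auto simp: card_eq_0_iff)
        then obtain c where c: "c \<in> L v"
          "stage (U - {v}) (play v c L) (F - {c}) (P(f v \<mapsto> c))"
          "card F = card (F - {c}) + 1"
          "card (unsafe (U - {v}) (P(f v \<mapsto> c))) + 1 \<le> card (unsafe U P)"
          using maker_touch[OF st v] by blast
        have "breaker_loses (U - {v}) (play v c L)"
          by (rule less.hyps(1)[OF sm(1)[OF v(1)] _ c(2)])
            (use 2(1) c(3,4) sm(2)[OF v(1)] in linarith)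
        then show ?thesis using v c maker_move by blast
      qed
    qed
  }
qed

lemma card_sum_cls: "finite U \<Longrightarrow> card U = (\<Sum>i\<in>f ` U. card (cls U i))"
  using sum.image_gen[of U "\<lambda>_. 1::nat" f] by (simp add: cls_def)

lemma odd_cls_exists:
  assumes "finite U" "odd (card U)"
  obtains i where "odd (card (cls U i))"
  using card_sum_cls[OF assms(1)] assms(2) by (metis dvd_sum)

lemma cls_remove: "cls (U - {v}) i = cls U i - {v}"
  by (auto simp: cls_def)

lemma finite_cls: "finite U \<Longrightarrow> finite (cls U i)"
  by (simp add: cls_def)

lemma card_cls_remove:
  assumes "finite U" "v \<in> U"
  shows "card (cls (U - {v}) i) = (if f v = i then card (cls U i) - 1 else card (cls U i))"
proof -
  have "v \<in> cls U i \<longleftrightarrow> f v = i" using assms by (auto simp: cls_def)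
  then show ?thesis using assms by (simp add: cls_remove card_Diff_singleton_if)
qed

lemma cls_pos: "finite U \<Longrightarrow> v \<in> U \<Longrightarrow> 0 < card (cls U (f v))"
  by (auto simp: cls_def card_gt_0_iff)

text \<open>
  The balance may be one below the bound of \<open>wins_with_ample_fresh_colours\<close> if on Breaker's turns all safe
  classes, and the whole position, have an even number of unplayed vertices. After a productive move of
  Breaker in a safe class, Maker restores evenness in that class. After a spoiling move in an unsafe
  class, the unplayed vertices of some unsafe class are odd in number, and Maker touches that one. In
  the end two vertices are left. If a class with unplayed vertices is safe then, they both belong to it,
  and otherwise Breaker has no productive move. The index \<open>j\<close> allows for the single
  safe class whose parity Breaker has just changed.
\<close>

lemma wins_if_safe_classes_even:
  assumes "stage U L F P"
  shows "even (card U) \<Longrightarrow> (\<forall>i\<in>dom P. even (card (cls U i))) \<Longrightarrow>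
      card (unsafe U P) + card U div 2 \<le> card F + 1 \<Longrightarrow> breaker_loses U L"
    and "odd (card U) \<Longrightarrow> (\<forall>i\<in>dom P. i \<noteq> j \<longrightarrow> even (card (cls U i))) \<Longrightarrow>
      card (unsafe U P) + card U div 2 \<le> card F + 1 \<Longrightarrow>
      F \<noteq> {} \<or> (\<exists>i\<in>dom P. odd (card (cls U i))) \<Longrightarrow> maker_wins U L"
  using assms
proof (induction "card U" arbitrary: U L F P j rule: less_induct)
  case less
  {
    case 1
    note ev = 1(1,2) and count = 1(3) and st = 1(4)
    have fin: "finite U" "finite F" using st by (auto simp: stage_def)
    show ?case
    proof (cases "U = {}")
      case True then show ?thesis by (simp add: breaker_done)
    next
      case False
      then obtain v0 where v0: "v0 \<in> U" by auto
      have "card U \<noteq> 0" using False fin by simp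
      with ev(1) obtain k where "card U = 2 * k" "k \<noteq> 0" by (auto elim!: evenE)
      then obtain h where h: "card U = 2 * h + 2" by (cases k) auto
      have count: "card (unsafe U P) + h \<le> card F" using count h by simp
      have sm: "card (U - {v}) < card U" "card (U - {v}) = 2 * h + 1"
        "odd (card (U - {v}))" "card (U - {v}) div 2 = h" "(card (U - {v}) - 1) div 2 = h"
        if "v \<in> U" for v
        using that fin card_Diff1_less[of U v] h by auto
      have pos: "F \<noteq> {} \<or> f v \<in> dom P" if "v \<in> U" for v
      proof (rule ccontr)
        assume "\<not> ?thesis"
        then have "f v \<in> unsafe U P" "card F = 0" using that by (auto simp: unsafe_def)
        moreover from this have "0 < card (unsafe U P)"
          using finite_unsafe[OF fin(1), of P] card_gt_0_iff by blast
        ultimately show False using count by linarith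
      qed
      show ?thesis
      proof (rule breaker_move)
        show "\<exists>v\<in>U. L v \<noteq> {}" using stage_has_move[OF st v0] pos[OF v0] v0 by blast
      next
        fix v c assume v: "v \<in> U" and "c \<in> L v"
        from st v show "maker_wins (U - {v}) (play v c L)"
        proof (cases rule: breaker_move_cases[where c = c])
          case (fail F' P')
          show ?thesis
            by (rule wins_with_ample_fresh_colours(2)[OF fail(1)]) (use fail(2) count in \<open>unfold sm(5)[OF v], linarith\<close>)
        next
          case waste
          have "card F = card (F - {c}) + 1" using waste fin
            by (metis Suc_eq_plus1 card.remove)
          moreover have "odd (card (cls (U - {v}) (f v)))"
            using ev(2) waste(2) cls_pos[OF fin(1) v] by (auto simp: card_cls_remove fin v)
          ultimately have
            "F - {c} \<noteq> {} \<or> (\<exists>i\<in>dom P. odd (card (cls (U - {v}) i)))"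
            "card (unsafe (U - {v}) P) + card (U - {v}) div 2 \<le> card (F - {c}) + 1"
            using card_unsafe_remove[OF fin(1), of v P] waste(2) count
            unfolding sm(4)[OF v] by (blast, linarith)
          then show ?thesis
            by (intro less.hyps(2)[OF sm(1)[OF v] _ _ _ _ waste(3), of "f v"])
              (use sm(3)[OF v] ev(2) card_cls_remove[OF fin(1) v] in simp_all)
        next
          case (spoil i)
          have "F \<noteq> {} \<or> (\<exists>i\<in>dom (P(i := None)). odd (card (cls (U - {v}) i)))"
          proof (cases "f v \<in> dom P")
            case True
            then have "odd (card (cls (U - {v}) (f v)))"
              using ev(2) cls_pos[OF fin(1) v] by (auto simp: card_cls_remove fin v)
            then show ?thesis using True spoil(2) by auto
          qed (use pos[OF v] in auto)
          moreover have
            "card (unsafe (U - {v}) (P(i := None))) + card (U - {v}) div 2 \<le> card F + 1"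
            using card_unsafe_spoil[OF fin(1), of v P i] count unfolding sm(4)[OF v]
            by linarith
          ultimately show ?thesis
            by (intro less.hyps(2)[OF sm(1)[OF v] _ _ _ _ spoil(3), of "f v"])
              (use sm(3)[OF v] ev(2) card_cls_remove[OF fin(1) v] in simp_all)
        qed
      next
        fix v assume v: "v \<in> U"
        show "maker_wins (U - {v}) L"
          by (rule wins_with_ample_fresh_colours(2)[OF stage_blank[OF st]])
            (use card_unsafe_remove[OF fin(1), of v P] count in \<open>unfold sm(5)[OF v], linarith\<close>)
      qed
    qed
  next
    case 2
    note od = 2(1,2) and count = 2(3) and st = 2(5)
    have fin: "finite U" "finite F" using st by (auto simp: stage_def)
    obtain h where h: "card U = 2 * h + 1" using od(1) by (auto elim!: oddE)
    have count: "card (unsafe U P) + h \<le> card F + 1" using count h by simp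
    have sm: "card (U - {v}) < card U" "even (card (U - {v}))" "card (U - {v}) div 2 = h"
      if "v \<in> U" for v
      using that fin card_Diff1_less[of U v] h by auto
    show ?case
    proof (cases "\<exists>i\<in>dom P. odd (card (cls U i))")
      case True
      then obtain i c where i: "P i = Some c" "odd (card (cls U i))" by auto
      then obtain v where v: "v \<in> U" "f v = i" by (force simp: cls_def dest: odd_card_imp_not_empty)
      have ij: "i = j" using i od(2) by auto
      have "breaker_loses (U - {v}) (play v c L)"
      proof (rule less.hyps(1)[OF sm(1)[OF v(1)] _ _ _ stage_private[OF st]])
        show "P (f v) = Some c" using i v by simp
        show "even (card (U - {v}))" using sm(2)[OF v(1)] .
        show "\<forall>k\<in>dom P. even (card (cls (U - {v}) k))"
          using card_cls_remove[OF fin(1) v(1)] i(2) od(2) ij v(2) by simp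
        show "card (unsafe (U - {v}) P) + card (U - {v}) div 2 \<le> card F + 1"
          using count card_unsafe_remove[OF fin(1), of v P] unfolding sm(3)[OF v(1)] by linarith
      qed
      moreover have "c \<in> L v" using st v i by (auto simp: stage_def)
      ultimately show ?thesis using v maker_move by blast
    next
      case False
      then have F: "F \<noteq> {}" using 2(4) by auto
      obtain i where i: "odd (card (cls U i))" using odd_cls_exists[OF fin(1) od(1)] by blast
      then obtain v where v: "v \<in> U" "f v = i" by (force simp: cls_def dest: odd_card_imp_not_empty)
      then have "f v \<notin> dom P" using i False by auto
      from maker_touch[OF st v(1) this F] obtain c where c: "c \<in> L v"
        "stage (U - {v}) (play v c L) (F - {c}) (P(f v \<mapsto> c))"
        "card F = card (F - {c}) + 1"
        "card (unsafe (U - {v}) (P(f v \<mapsto> c))) + 1 \<le> card (unsafe U P)"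
        by blast
      have "breaker_loses (U - {v}) (play v c L)"
      proof (rule less.hyps(1)[OF sm(1)[OF v(1)] _ _ _ c(2)])
        show "even (card (U - {v}))" using sm(2)[OF v(1)] .
        show "\<forall>k\<in>dom (P(f v \<mapsto> c)). even (card (cls (U - {v}) k))"
          using card_cls_remove[OF fin(1) v(1)] i False v(2) by auto
        show "card (unsafe (U - {v}) (P(f v \<mapsto> c))) + card (U - {v}) div 2 \<le> card (F - {c}) + 1"
          using count c(3,4) unfolding sm(3)[OF v(1)] by linarith
      qed
      then show ?thesis using v c maker_move by blast
    qed
  }
qed

text \<open>
  With at least three vertices left, the side condition of the second part of
  \<open>wins_if_safe_classes_even\<close> is automatic: if all safe classes are even, there is an unsafe class,
  and then the count provides a fresh colour.
\<close>

lemma maker_wins_odd_turn: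
  assumes st: "stage U L F P" and m: "odd (card U)" "3 \<le> card U"
    and ev: "\<forall>i\<in>dom P. i \<noteq> j \<longrightarrow> even (card (cls U i))"
    and count: "card (unsafe U P) + card U div 2 \<le> card F + 1"
  shows "maker_wins U L"
proof (rule wins_if_safe_classes_even(2)[OF st m(1) ev count])
  have fin: "finite U" using st by (auto simp: stage_def)
  show "F \<noteq> {} \<or> (\<exists>i\<in>dom P. odd (card (cls U i)))"
  proof (rule disjCI)
    assume no: "\<not> (\<exists>i\<in>dom P. odd (card (cls U i)))"
    obtain i where i: "odd (card (cls U i))" using odd_cls_exists[OF fin m(1)] by blast
    then have "i \<notin> dom P" using no by auto
    moreover have "i \<in> f ` U"
      using i by (force simp: cls_def dest: odd_card_imp_not_empty)
    ultimately have "0 < card (unsafe U P)"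
      using finite_unsafe[OF fin, of P] by (auto simp: card_gt_0_iff unsafe_def)
    moreover have "1 \<le> card U div 2" using m(2) by simp
    ultimately have "card F \<noteq> 0" using count by linarith
    then show "F \<noteq> {}" by auto
  qed
qed

lemma unsafe_empty: "unsafe U Map.empty = f ` U"
  by (simp add: unsafe_def)

section \<open>Forcing two unproductive moves\<close>

text \<open>
  Without a safe class, both kinds of productive moves are impossible. After Breaker's unproductive
  move at most one class is safe, so the results on one unproductive move apply.
\<close>

lemma breaker_loses_without_safe_class:
  assumes st: "stage U L F Map.empty" and m: "3 \<le> card U"
    and count: "card (f ` U) + (card U + 1) div 2 \<le> card F + 2"
  shows "breaker_loses U L"
proof -
  have fin: "finite U" "finite F" using st by (auto simp: stage_def)
  have "U \<noteq> {}" using m by auto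
  then obtain v0 where v0: "v0 \<in> U" by auto
  have "0 < card (f ` U)" using v0 fin by (auto simp: card_gt_0_iff)
  then have F: "F \<noteq> {}" using count m by auto
  have win: "maker_wins (U - {v}) L'"
    if v: "v \<in> U" and st': "stage (U - {v}) L' F' P'" and dom: "dom P' \<subseteq> {f v}"
      and c': "card F + card (unsafe (U - {v}) P') \<le> card F' + card (f ` U)" for v L' F' P'
  proof (cases "even (card U)")
    case False
    show ?thesis
      by (rule wins_with_ample_fresh_colours(2)[OF st']) (use c' count m False v fin in \<open>auto elim!: oddE\<close>)
  next
    case True
    then obtain k where k: "card U = 2 * k" "2 \<le> k" using m by (auto elim!: evenE)
    have c: "card (U - {v}) = 2 * (k - 1) + 1" using v fin k by simp
    show ?thesis
    proof (rule maker_wins_odd_turn[OF st', of "f v"])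
      have "card (U - {v}) div 2 = k - 1" using c by simp
      then show "card (unsafe (U - {v}) P') + card (U - {v}) div 2 \<le> card F' + 1"
        using c' count k by simp
    qed (use c k dom in auto)
  qed
  show ?thesis
  proof (rule breaker_move)
    show "\<exists>v\<in>U. L v \<noteq> {}" using stage_has_move[OF st v0] F v0 by blast
  next
    fix v c assume v: "v \<in> U" and "c \<in> L v"
    from st v show "maker_wins (U - {v}) (play v c L)"
    proof (cases rule: breaker_move_cases[where c = c])
      case (fail F' P')
      then show ?thesis by (intro win[OF v]) (auto simp: unsafe_empty)
    qed auto
  next
    fix v assume v: "v \<in> U"
    show "maker_wins (U - {v}) L"
      using card_unsafe_remove[OF fin(1), of v Map.empty]
      by (intro win[OF v stage_blank[OF st]]) (auto simp: unsafe_empty)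
  qed
qed

text \<open>
  A colour outside \<open>F\<close> costs nothing and makes no class safe in the accounting, so Maker can
  pass the turn to Breaker while there is no safe class.
\<close>

lemma maker_wins_by_tempo:
  assumes st: "stage U L F Map.empty" and m: "4 \<le> card U"
    and count: "card (f ` U) + card U div 2 \<le> card F + 2"
    and w: "w \<in> U" "c \<in> L w" "c \<notin> F"
  shows "maker_wins U L"
proof -
  have fin: "finite U" "finite F" using st by (auto simp: stage_def)
  have "card (U - {w}) = card U - 1" using w fin by simp
  moreover have "card (f ` (U - {w})) \<le> card (f ` U)" using fin by (intro card_mono) auto
  ultimately have "breaker_loses (U - {w}) (play w c L)"
    using m count by (intro breaker_loses_without_safe_class[OF stage_other[OF st]]) (use w in auto)
  then show ?thesis using w maker_move by blast
qed

text \<open>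
  Maker, to move, wins on the graph induced by \<open>U\<close> with (number of classes) + (half the number of
  vertices, rounded down) - 2 fresh colours. The lists are otherwise arbitrary, so that this applies to what
  remains of a larger game, where colours used before may still be legal at some vertices.
\<close>

definition fresh_win :: "'a set \<Rightarrow> bool" where
  "fresh_win U \<longleftrightarrow> (\<forall>L F. stage U L F Map.empty \<longrightarrow>
     card (f ` U) + card U div 2 \<le> card F + 2 \<longrightarrow> maker_wins U L)"

text \<open>
  A vertex with such a witness \<open>K\<close> is always colourable: each neighbour that takes a colour of \<open>K\<close> also
  leaves the set counted on the left. Besides vertices of small degree (\<open>K\<close> large), this covers vertices
  with a colour that no unplayed neighbour can take (\<open>K\<close> a singleton).
\<close>

definition comfortable :: "'a set \<Rightarrow> ('a \<Rightarrow> nat set) \<Rightarrow> 'a \<Rightarrow> bool" where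
  "comfortable U L v \<longleftrightarrow>
     (\<exists>K. finite K \<and> K \<subseteq> L v \<and> card {w \<in> U. adj v w \<and> L w \<inter> K \<noteq> {}} < card K)"

lemma comfortable_blank:
  assumes "finite U" "comfortable U L u"
  shows "comfortable (U - {v}) L u"
proof -
  from assms(2) obtain K where K: "finite K" "K \<subseteq> L u"
    "card {w \<in> U. adj u w \<and> L w \<inter> K \<noteq> {}} < card K"
    by (auto simp: comfortable_def)
  have "card {w \<in> U - {v}. adj u w \<and> L w \<inter> K \<noteq> {}} \<le> card {w \<in> U. adj u w \<and> L w \<inter> K \<noteq> {}}"
    using assms(1) by (intro card_mono) auto
  then show ?thesis using K unfolding comfortable_def by (meson le_less_trans)
qed

lemma comfortable_play:
  assumes fin: "finite U" and u: "comfortable U L u" and v: "v \<in> U" "c \<in> L v"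
  shows "comfortable (U - {v}) (play v c L) u"
proof -
  from u obtain K where K: "finite K" "K \<subseteq> L u"
    "card {w \<in> U. adj u w \<and> L w \<inter> K \<noteq> {}} < card K"
    by (auto simp: comfortable_def)
  let ?N = "{w \<in> U. adj u w \<and> L w \<inter> K \<noteq> {}}"
  have fN: "finite ?N" using fin by simp
  show ?thesis
  proof (cases "adj v u \<and> c \<in> K")
    case True
    let ?N' = "{w \<in> U - {v}. adj u w \<and> play v c L w \<inter> (K - {c}) \<noteq> {}}"
    have "?N' \<subseteq> ?N - {v}" by (auto simp: in_play)
    moreover have "v \<in> ?N" using True v adj_sym by auto
    ultimately have "?N' \<subset> ?N" by blast
    then have "card ?N' < card ?N" using psubset_card_mono[OF fN] by blast
    also have "\<dots> \<le> card (K - {c})" using K True by simp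
    finally have "card ?N' < card (K - {c})" .
    moreover have "K - {c} \<subseteq> play v c L u" using K(2) by (auto simp: in_play)
    ultimately show ?thesis unfolding comfortable_def using K(1) by (meson finite_Diff)
  next
    case False
    let ?N' = "{w \<in> U - {v}. adj u w \<and> play v c L w \<inter> K \<noteq> {}}"
    have "?N' \<subseteq> ?N" by (auto simp: in_play)
    then have "card ?N' < card K" using K(3) card_mono[OF fN] by (meson le_less_trans)
    moreover have "K \<subseteq> play v c L u" using K(2) False by (auto simp: in_play)
    ultimately show ?thesis unfolding comfortable_def using K(1) by blast
  qed
qed

lemma comfortable_wins:
  assumes "finite U" "\<forall>v\<in>U. comfortable U L v"
  shows "maker_wins U L \<and> breaker_loses U L"
  using assms
proof (induction "card U" arbitrary: U L rule: less_induct)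
  case less
  have av: "L v \<noteq> {}" if "v \<in> U" for v
    using less.prems(2) that by (force simp: comfortable_def)
  have sub: "maker_wins (U - {v}) L' \<and> breaker_loses (U - {v}) L'"
    if "v \<in> U" "\<forall>u\<in>U. comfortable (U - {v}) L' u" for v L'
    by (rule less.hyps[OF card_Diff1_less[OF less.prems(1) that(1)]])
      (use less.prems(1) that(2) in auto)
  have col: "maker_wins (U - {v}) (play v c L) \<and> breaker_loses (U - {v}) (play v c L)"
    if v: "v \<in> U" "c \<in> L v" for v c
    using comfortable_play[OF less.prems(1) _ v(1), of L _ c] v(2) less.prems(2)
    by (intro sub[OF v(1)]) blast
  have bl: "maker_wins (U - {v}) L" if "v \<in> U" for v
    using comfortable_blank[OF less.prems(1)] less.prems(2) sub[OF that] by blast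
  show ?case
  proof (cases "U = {}")
    case True then show ?thesis by (simp add: maker_done breaker_done)
  next
    case False
    then obtain v where v: "v \<in> U" by blast
    then obtain c where c: "c \<in> L v" using av by blast
    have "maker_wins U L" using maker_move[of v U c L] v c col[OF v c] by blast
    moreover have "breaker_loses U L"
    proof (rule breaker_move)
      show "\<exists>v\<in>U. L v \<noteq> {}" using av v by blast
    qed (use col bl in auto)
    ultimately show ?thesis ..
  qed
qed

lemma fresh_win_small_degree:
  assumes deg: "\<And>v. v \<in> U \<Longrightarrow> card {w \<in> U. adj v w} + 2 < card (f ` U) + card U div 2"
  shows "fresh_win U"
  unfolding fresh_win_def
proof (intro allI impI)
  fix L F assume st: "stage U L F Map.empty" and count: "card (f ` U) + card U div 2 \<le> card F + 2"
  have fin: "finite U" "finite F" using st by (auto simp: stage_def)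
  have "comfortable U L v" if v: "v \<in> U" for v
  proof -
    have "card {w \<in> U. adj v w \<and> L w \<inter> F \<noteq> {}} \<le> card {w \<in> U. adj v w}"
      using fin by (intro card_mono) auto
    also have "\<dots> < card F" using deg[OF v] count by linarith
    finally have "card {w \<in> U. adj v w \<and> L w \<inter> F \<noteq> {}} < card F" .
    moreover have "F \<subseteq> L v" using st v by (auto simp: stage_def)
    ultimately show ?thesis using fin(2) unfolding comfortable_def by blast
  qed
  then show "maker_wins U L" using comfortable_wins fin by blast
qed

lemma fresh_win_one_class:
  assumes "f ` U = {i}" "4 \<le> card U"
  shows "fresh_win U"
proof (rule fresh_win_small_degree)
  fix v assume v: "v \<in> U"
  have "f w = i" if "w \<in> U" for w using assms(1) that by blast
  then have "{w \<in> U. adj v w} = {}" using v by (auto dest: proper)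
  then have "card {w \<in> U. adj v w} = 0" by (simp only: card.empty)
  then show "card {w \<in> U. adj v w} + 2 < card (f ` U) + card U div 2"
    using assms by simp
qed

section \<open>Exhausting a class\<close>

text \<open>
  Maker is playing the class \<open>C\<close> with colour \<open>a\<close>. The set \<open>T\<close> is the played part of \<open>C\<close>, and \<open>A\<close> the part of
  it that Maker coloured; Breaker has used fresh colours on the rest. Breaker can avoid unproductive
  moves in three ways only. If \<open>C\<close> is exhausted by Maker, Breaker has to move without a safe class. If it is exhausted by Breaker, or spoiled
  by giving \<open>a\<close> to a vertex \<open>u\<close> of another class, Maker is to move without a safe class and with the right
  number of fresh colours. If in these cases \<open>a\<close> is still legal somewhere, he has a tempo move;
  hence the assumptions \<open>ex\<close> and \<open>sp\<close> only concern the case that all remaining vertices see \<open>a\<close>.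
  The assumption \<open>par\<close> ensures that at most one safe class is odd after an unproductive move of Breaker.
\<close>

lemma breaker_loses_exhausting:
  assumes st: "stage (U - T) L F [i \<mapsto> a]"
    and fin: "finite U"
    and C: "C = cls U i"
    and T: "T \<subseteq> C" and A: "v \<in> A" "A \<subseteq> T" "card T + 1 = 2 * card A"
    and seen: "\<And>w. w \<in> U - T \<Longrightarrow> a \<in> L w \<longleftrightarrow> (\<forall>x\<in>A. \<not> adj w x)"
    and count: "card (f ` (U - C)) + (card (U - T) + 1) div 2 \<le> card F + 2"
    and rest: "3 \<le> card (U - C)" "even (card C) \<Longrightarrow> 4 \<le> card (U - C)"
    and par: "even (card U) \<or> odd (card C) \<or> card (f ` U) = 2"
    and ex: "\<And>A. even (card C) \<Longrightarrow> v \<in> A \<Longrightarrow> A \<subseteq> C \<Longrightarrow> 2 * card A = card C \<Longrightarrow>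
      \<forall>w\<in>U - C. \<exists>x\<in>A. adj w x \<Longrightarrow> fresh_win (U - C)"
    and sp: "\<And>A T u. v \<in> A \<Longrightarrow> A \<subseteq> T \<Longrightarrow> T \<subset> C \<Longrightarrow> card T + 1 = 2 * card A \<Longrightarrow> u \<in> U - C \<Longrightarrow>
      \<forall>x\<in>A. \<not> adj u x \<Longrightarrow> \<forall>w\<in>U - T - {u}. \<exists>x\<in>insert u A. adj w x \<Longrightarrow> fresh_win (U - T - {u})"
  shows "breaker_loses (U - T) L"
  using st T A seen count
proof (induction "card (C - T)" arbitrary: T A L F rule: less_induct)
  case less
  note st = less.prems(1) and T = less.prems(2) and A = less.prems(3-5) and seen = less.prems(6)
    and count = less.prems(7)
  have finF: "finite F" using stage_finite(2)[OF st] .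
  have aF: "a \<notin> F" using stage_private_not_fresh[OF st, of i] by simp
  have CU: "C \<subseteq> U" using C by (auto simp: cls_def)
  have inC: "w \<in> C \<longleftrightarrow> f w = i" if "w \<in> U" for w using that C by (auto simp: cls_def)
  have finC: "finite C" using finite_subset[OF CU fin] .
  have finT: "finite T" using finite_subset[OF T finC] .
  define r where "r = card (U - C)"
  define t where "t = card (C - T)"
  have split: "U - T = (U - C) \<union> (C - T)" using T CU by blast
  have size: "card (U - T) = r + t"
    unfolding r_def t_def split using fin finC by (intro card_Un_disjoint) auto
  have cardC: "card C = card T + t"
    unfolding t_def using card_Diff_subset[OF finT T] card_mono[OF finC T] by simp
  have cardU: "card U = r + card C"
    unfolding r_def using card_Diff_subset[OF finC CU] card_mono[OF fin CU] by simp
  have parT: "odd (card T)" using A(3) by presburger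
  have uns: "unsafe (U - T) [i \<mapsto> a] = f ` (U - C)"
    unfolding unsafe_def split using C by (auto simp: cls_def)
  show ?case
  proof (cases "C - T = {}")
    case True
    then have "U - T = U - C" using T by blast
    then show ?thesis
      using breaker_loses_without_safe_class[OF stage_drop[OF st]] rest count by simp
  next
    case False
    then obtain x0 where x0: "x0 \<in> C - T" by blast
    have t1: "1 \<le> t" unfolding t_def using False finC by (simp add: Suc_le_eq card_gt_0_iff)
    have big: "5 \<le> r + t"
    proof -
      have "2 \<le> t \<and> 3 \<le> r \<or> 4 \<le> r"
      proof (cases "even (card C)")
        case False
        then have "even t" using cardC parT by simp
        then show ?thesis using t1 rest(1) r_def by presburger
      qed (use rest(2) r_def in simp)
      then show "5 \<le> r + t" using t1 by auto
    qed
    have win: "maker_wins (U - T - {u}) L'"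
      if u: "u \<in> U - T" and st': "stage (U - T - {u}) L' F' P'" and dom: "dom P' \<subseteq> {i, f u}"
        and c': "card F + card (unsafe (U - T - {u}) P') \<le> card F' + card (f ` (U - C))"
      for u L' F' P'
    proof -
      have sz: "card (U - T - {u}) = r + t - 1" using u fin size by simp
      show ?thesis
      proof (cases "even (r + t)")
        case False
        then obtain h where h: "r + t = 2 * h + 1" by (rule oddE)
        show ?thesis
        proof (rule wins_with_ample_fresh_colours(2)[OF st'])
          have "(card (U - T - {u}) - 1) div 2 = h - 1" using sz h by simp
          then show "card (unsafe (U - T - {u}) P') + (card (U - T - {u}) - 1) div 2 \<le> card F'"
            using c' count h size big by simp
        qed
      next
        case True
        then obtain h where "r + t = 2 * h" by (rule evenE)
        then have h: "r + t = 2 * h" "2 \<le> h" using big by simp_all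
        have sz': "card (U - T - {u}) = 2 * (h - 1) + 1" using sz h by simp
        \<comment> \<open>Only \<open>i\<close> and \<open>f u\<close> can be safe now. An even \<open>C\<close> leaves an odd part; then there are only
          two classes, and the total being odd, the other one is even.\<close>
        have "\<exists>j. \<forall>k\<in>dom P'. k \<noteq> j \<longrightarrow> even (card (cls (U - T - {u}) k))"
        proof (cases "f u = i")
          case fu: False
          then have ci: "cls (U - T - {u}) i = C - T"
            using C by (auto simp: cls_def)
          show ?thesis
          proof (cases "odd (card C)")
            case True
            then have "even t" using cardC parT by simp
            then have "\<forall>k\<in>dom P'. k \<noteq> f u \<longrightarrow> even (card (cls (U - T - {u}) k))"
              using dom ci t_def by auto
            then show ?thesis by blast
          next
            case False
            then have "odd t" using cardC parT by simp
            then have "card (f ` U) = 2" using par cardU False True by simp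
            then obtain p q where pq: "f ` U = {p, q}" by (auto simp: card_2_iff)
            have "i \<in> f ` U" "f u \<in> f ` U" using x0 CU inC u by blast+
            then have two: "f w = i \<or> f w = f u" if "w \<in> U" for w
              using pq that fu by (metis imageI insertE singletonD)
            have "U - T - {u} = cls (U - T - {u}) (f u) \<union> (C - T)"
              unfolding ci[symmetric] using two by (auto simp: cls_def)
            moreover have "cls (U - T - {u}) (f u) \<inter> (C - T) = {}"
              using fu C by (auto simp: cls_def)
            ultimately have "card (U - T - {u}) = card (cls (U - T - {u}) (f u)) + t"
              unfolding t_def
              by (metis card_Un_disjoint fin finite_Diff finC(1) finite_cls)
            moreover have "odd (card (U - T - {u}))" using sz' by simp
            ultimately have "even (card (cls (U - T - {u}) (f u)))" using \<open>odd t\<close> by simp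
            then have "\<forall>k\<in>dom P'. k \<noteq> i \<longrightarrow> even (card (cls (U - T - {u}) k))"
              using dom by auto
            then show ?thesis by blast
          qed
        qed (use dom in blast)
        then obtain j where j: "\<forall>k\<in>dom P'. k \<noteq> j \<longrightarrow> even (card (cls (U - T - {u}) k))" ..
        show ?thesis
        proof (rule maker_wins_odd_turn[OF st' _ _ j])
          have "card (U - T - {u}) div 2 = h - 1" using sz' by simp
          then show "card (unsafe (U - T - {u}) P') + card (U - T - {u}) div 2 \<le> card F' + 1"
            using c' count h size by simp
          show "3 \<le> card (U - T - {u})" using sz big by simp
          show "odd (card (U - T - {u}))" using sz' by simp
        qed
      qed
    qed
    show ?thesis
    proof (rule breaker_move)
      have "x0 \<in> U - T" "f x0 = i" using x0 CU inC by auto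
      then show "\<exists>w\<in>U - T. L w \<noteq> {}" using stage_has_move[OF st, of x0] by auto
    next
      fix u assume u: "u \<in> U - T"
      show "maker_wins (U - T - {u}) L"
      proof (rule win[OF u stage_blank[OF st]])
        show "card F + card (unsafe (U - T - {u}) [i \<mapsto> a]) \<le> card F + card (f ` (U - C))"
          using card_unsafe_remove[of "U - T" u "[i \<mapsto> a]"] fin uns by simp
      qed auto
    next
      fix u c assume u: "u \<in> U - T" and c: "c \<in> L u"
      from st u show "maker_wins (U - T - {u}) (play u c L)"
      proof (cases rule: breaker_move_cases[where c = c])
        case (fail F' P')
        then show ?thesis by (intro win[OF u fail(1)]) (auto simp: uns)
      next
        case waste
        then have uC: "u \<in> C - T" using u inC by auto
        have ca: "c \<noteq> a" using waste aF by auto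
        have cF: "card F = card (F - {c}) + 1" using waste finF
          by (metis Suc_eq_plus1 card.remove)
        show ?thesis
        proof (cases "C - T = {u}")
          case True
          then have rem: "U - T - {u} = U - C" using T CU by blast
          have t: "t = 1" unfolding t_def True by simp
          then have evC: "even (card C)" using cardC parT by simp
          have st': "stage (U - C) (play u c L) (F - {c}) Map.empty"
            using stage_drop[OF waste(3)] rem by simp
          have count': "card (f ` (U - C)) + card (U - C) div 2 \<le> card (F - {c}) + 2"
            using count cF size t r_def by simp
          show ?thesis
          proof (cases "\<exists>w\<in>U - C. a \<in> play u c L w")
            case True
            then obtain w where "w \<in> U - C" "a \<in> play u c L w" by blast
            then show ?thesis
              unfolding rem using maker_wins_by_tempo[OF st' rest(2)[OF evC] count'] aF by blast
          next
            case False
            have "fresh_win (U - C)"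
            proof (rule ex[OF evC A(1)])
              show "A \<subseteq> C" using A T by blast
              show "2 * card A = card C" using A(3) cardC t by simp
              show "\<forall>w\<in>U - C. \<exists>x\<in>A. adj w x"
              proof
                fix w assume w: "w \<in> U - C"
                then have "a \<notin> L w" using False ca by (auto simp: in_play)
                moreover have "w \<in> U - T" using w T by blast
                ultimately show "\<exists>x\<in>A. adj w x" using seen by blast
              qed
            qed
            then show ?thesis unfolding rem using st' count' by (auto simp: fresh_win_def)
          qed
        next
          case False
          then obtain x where x: "x \<in> C - T" "x \<noteq> u" using uC by blast
          have xi: "f x = i" using x CU inC by auto
          let ?L = "play u c L"
          let ?T = "insert x (insert u T)" and ?A = "insert x A"
          have rem: "U - T - {u} - {x} = U - ?T" by blast
          have "breaker_loses (U - ?T) (play x a ?L)"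
          proof (rule less.hyps)
            have "C - ?T \<subset> C - T" using x by blast
            then show "card (C - ?T) < card (C - T)" using finC by (simp add: psubset_card_mono)
            show "stage (U - ?T) (play x a ?L) (F - {c}) [i \<mapsto> a]"
              using stage_private[OF waste(3), of x a] xi by (simp add: rem)
            show "?T \<subseteq> C" using x uC T by blast
            show "v \<in> ?A" "?A \<subseteq> ?T" using A by auto
            have "x \<notin> A" using x A by blast
            moreover have "finite A" using finite_subset[OF A(2) finT] .
            moreover have "card ?T = card T + 2" using x uC finT by simp
            ultimately show "card ?T + 1 = 2 * card ?A" using A(3) by simp
            show "a \<in> play x a ?L w \<longleftrightarrow> (\<forall>y\<in>?A. \<not> adj w y)" if "w \<in> U - ?T" for w
            proof -
              have "w \<in> U - T" using that by blast
              then show ?thesis using seen[of w] ca adj_sym by (auto simp: in_play)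
            qed
            have "card (U - ?T) = card (U - T) - 2"
              unfolding rem[symmetric] using u x CU fin by auto
            then show "card (f ` (U - C)) + (card (U - ?T) + 1) div 2 \<le> card (F - {c}) + 2"
              using count cF size big by simp
          qed
          moreover have "x \<in> U - T - {u}" using x CU by auto
          moreover have "a \<in> ?L x"
          proof -
            have "a \<in> L x" using stage_private_available[OF st, of x a] x CU xi by auto
            then show ?thesis using ca by (simp add: in_play)
          qed
          ultimately show ?thesis using maker_move[of x "U - T - {u}" a ?L] rem by simp
        qed
      next
        case (spoil k)
        then have k: "k = i" "c = a" "f u \<noteq> i" by (auto split: if_splits)
        then have uC: "u \<in> U - C" using u inC by auto
        have st': "stage (U - T - {u}) (play u a L) F Map.empty"
          using stage_drop[OF spoil(3)] k by simp
        have sz: "card (U - T - {u}) = r + t - 1" using u fin size by simp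
        have "f ` (U - T - {u}) \<subseteq> insert i (f ` (U - C))"
          using inC by auto
        then have "card (f ` (U - T - {u})) \<le> card (insert i (f ` (U - C)))"
          using fin by (intro card_mono) auto
        also have "\<dots> \<le> card (f ` (U - C)) + 1" using fin by (simp add: card_insert_if)
        finally have count': "card (f ` (U - T - {u})) + card (U - T - {u}) div 2 \<le> card F + 2"
          using count size big unfolding sz by (simp add: le_diff_conv2 Suc_diff_le)
        show ?thesis
        proof (cases "\<exists>w\<in>U - T - {u}. a \<in> play u a L w")
          case True
          then obtain w where "w \<in> U - T - {u}" "a \<in> play u a L w" by blast
          then show ?thesis
            using maker_wins_by_tempo[OF st' _ count'] aF k sz big by auto
        next
          case False
          have "fresh_win (U - T - {u})"
          proof (rule sp[OF A(1,2) _ A(3) uC])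
            show "T \<subset> C" using T x0 by blast
            show "\<forall>x\<in>A. \<not> adj u x" using seen[OF u] c k by blast
            show "\<forall>w\<in>U - T - {u}. \<exists>x\<in>insert u A. adj w x"
            proof
              fix w assume w: "w \<in> U - T - {u}"
              then have "a \<notin> L w \<or> adj u w" using False by (auto simp: in_play)
              then show "\<exists>x\<in>insert u A. adj w x" using seen[of w] w adj_sym by blast
            qed
          qed
          then show ?thesis using st' count' k by (auto simp: fresh_win_def)
        qed
      qed
    qed
  qed
qed

text \<open>
  Main reduction: Maker starts at \<open>v\<close> and exhausts its class. In \<open>ex\<close> Breaker has taken the last vertex of
  the class, in \<open>sp\<close> he has spoiled it by playing its colour at \<open>u\<close>.
\<close>

lemma fresh_win_by_exhausting:
  assumes fin: "finite U" and v: "v \<in> U" and C: "C = cls U (f v)"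
    and rest: "3 \<le> card (U - C)" "even (card C) \<Longrightarrow> 4 \<le> card (U - C)"
    and par: "even (card U) \<or> odd (card C) \<or> card (f ` U) = 2"
    and ex: "\<And>A. even (card C) \<Longrightarrow> v \<in> A \<Longrightarrow> A \<subseteq> C \<Longrightarrow> 2 * card A = card C \<Longrightarrow>
      \<forall>w\<in>U - C. \<exists>x\<in>A. adj w x \<Longrightarrow> fresh_win (U - C)"
    and sp: "\<And>A T u. v \<in> A \<Longrightarrow> A \<subseteq> T \<Longrightarrow> T \<subset> C \<Longrightarrow> card T + 1 = 2 * card A \<Longrightarrow> u \<in> U - C \<Longrightarrow>
      \<forall>x\<in>A. \<not> adj u x \<Longrightarrow> \<forall>w\<in>U - T - {u}. \<exists>x\<in>insert u A. adj w x \<Longrightarrow> fresh_win (U - T - {u})"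
  shows "fresh_win U"
  unfolding fresh_win_def
proof (intro allI impI)
  fix L F assume st: "stage U L F Map.empty" and count: "card (f ` U) + card U div 2 \<le> card F + 2"
  have finF: "finite F" using stage_finite(2)[OF st] .
  have fC: "finite C" using C fin by (simp add: cls_def)
  have vC: "v \<in> C" using v C by (simp add: cls_def)
  have CU: "C \<subseteq> U" using C by (auto simp: cls_def)
  have "f ` U = insert (f v) (f ` (U - C))" using v C by (auto simp: cls_def)
  moreover have "f v \<notin> f ` (U - C)" using C by (auto simp: cls_def)
  ultimately have cf: "card (f ` U) = card (f ` (U - C)) + 1" using fin by simp
  have "card U = card (U - C) + card C"
    using card_Diff_subset[OF fC CU] card_mono[OF fin CU] by simp
  moreover have "1 \<le> card C" using vC fC by (simp add: Suc_le_eq card_gt_0_iff) blast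
  ultimately have "4 \<le> card U" using rest(1) by simp
  then have "F \<noteq> {}" using count cf by auto
  then obtain a where a: "a \<in> F" by blast
  have cF: "card F = card (F - {a}) + 1" using a finF by (metis Suc_eq_plus1 card.remove)
  have "breaker_loses (U - {v}) (play v a L)"
  proof (rule breaker_loses_exhausting[OF _ fin C _ _ _ _ _ _ rest par ex sp])
    show "stage (U - {v}) (play v a L) (F - {a}) [f v \<mapsto> a]"
      using stage_touch[OF st a, of v] by simp
    show "a \<in> play v a L w \<longleftrightarrow> (\<forall>x\<in>{v}. \<not> adj w x)" if "w \<in> U - {v}" for w
      using stage_fresh_available[OF st _ a, of w] that adj_sym by (auto simp: in_play)
    have "card (U - {v}) + 1 = card U" using v fin \<open>4 \<le> card U\<close> by simp
    then show "card (f ` (U - C)) + (card (U - {v}) + 1) div 2 \<le> card (F - {a}) + 2"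
      using count cf cF by simp
  qed (use vC in auto)
  then show "maker_wins U L"
    using maker_move[of v U a L] v stage_fresh_available[OF st v a] by blast
qed

section \<open>Special positions\<close>

text \<open>
  A singleton class is exhausted at once and gives Breaker no chance to spoil it.
\<close>

lemma fresh_win_singleton:
  assumes fin: "finite U" and m: "4 \<le> card U" and v: "v \<in> U" "card (cls U (f v)) = 1"
  shows "fresh_win U"
proof -
  have C: "cls U (f v) = {v}"
    using v by (metis (mono_tags, lifting) card_1_singletonE cls_def mem_Collect_eq singletonD)
  show ?thesis
    by (rule fresh_win_by_exhausting[OF fin v(1) refl]) (use C m v fin in auto)
qed

text \<open>
  In a class of size three, Breaker can spoil only right after Maker's first move.
\<close>

lemma subset_of_triple:
  assumes "card C = 3" "v \<in> A" "A \<subseteq> T" "T \<subset> C" "card T + 1 = 2 * card A"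
  shows "T = {v} \<and> A = {v}"
proof -
  have fC: "finite C" using assms(1) by (simp add: card_ge_0_finite)
  then have "card T < 3" using psubset_card_mono[OF fC assms(4)] assms(1) by simp
  then have "card T = 1" using assms(5) by presburger
  then show ?thesis using assms(2,3) by (metis card_1_singletonE empty_iff insert_iff subset_singletonD)
qed

text \<open>
  Maker starts at \<open>x\<close>. If Breaker takes the other vertex of its class, then the colour of \<open>x\<close> is still
  legal at \<open>y\<close>. If Breaker spoils, then the other vertex is left as a singleton class.
\<close>

lemma fresh_win_pairs:
  assumes fin: "finite U" and m: "6 \<le> card U" and two: "\<And>v. v \<in> U \<Longrightarrow> card (cls U (f v)) = 2"
    and xy: "x \<in> U" "y \<in> U" "f x \<noteq> f y" "\<not> adj y x"
  shows "fresh_win U"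
proof -
  let ?C = "cls U (f x)"
  have fC: "finite ?C" using fin by (simp add: cls_def)
  have CU: "?C \<subseteq> U" by (auto simp: cls_def)
  have cR: "card (U - ?C) = card U - 2" using card_Diff_subset[OF fC CU] two[OF xy(1)] by simp
  have ev: "even (card U)"
  proof (rule ccontr)
    assume "odd (card U)"
    then obtain i where i: "odd (card (cls U i))" using odd_cls_exists fin by blast
    then obtain v where "v \<in> U" "f v = i" by (force simp: cls_def dest: odd_card_imp_not_empty)
    then show False using two i by auto
  qed
  show ?thesis
  proof (rule fresh_win_by_exhausting[OF fin xy(1) refl])
    fix A assume A: "x \<in> A" "2 * card A = card ?C" "\<forall>w\<in>U - ?C. \<exists>x\<in>A. adj w x"
    have "card A = 1" using A(2) two[OF xy(1)] by simp
    then have "A = {x}" using A(1) by (metis card_1_singletonE singletonD)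
    moreover have "y \<in> U - ?C" using xy by (simp add: cls_def)
    ultimately show "fresh_win (U - ?C)" using A(3) xy(4) by blast
  next
    fix A T u assume T: "x \<in> A" "A \<subseteq> T" "T \<subset> ?C" and u: "u \<in> U - ?C"
    have TU: "T \<subseteq> U" using T CU by blast
    have fT: "finite T" using finite_subset[OF _ fC] T(3) by blast
    have "card T < 2" using psubset_card_mono[OF fC T(3)] two[OF xy(1)] by simp
    moreover have "0 < card T" using T fT by (auto simp: card_gt_0_iff)
    ultimately have T1: "card T = 1" by simp
    have cl: "cls (U - T - {u}) (f x) = ?C - T" using u by (auto simp: cls_def)
    have c1: "card (?C - T) = 1" using card_Diff_subset[OF fT, of ?C] T T1 two[OF xy(1)] by auto
    then obtain x' where x': "?C - T = {x'}" by (auto simp: card_1_singleton_iff)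
    have "x' \<in> U - T - {u}" "f x' = f x" using x' u by (auto simp: cls_def)
    moreover have "u \<in> U - T" using u T by blast
    then have "card (U - T - {u}) = card U - 2"
      using card_Diff_subset[OF fT TU] T1 by (simp add: card_Diff_singleton)
    ultimately show "fresh_win (U - T - {u})"
      using fin m cl c1 by (intro fresh_win_singleton[of _ x']) auto
  qed (use cR m ev in auto)
qed

text \<open>
  A vertex that sees the whole other class cannot be spoiled. Without such a vertex all degrees are at
  most two, while there are three fresh colours.
\<close>

lemma fresh_win_three_three:
  assumes fin: "finite U" and fU: "card (f ` U) = 2" and m: "card U = 6"
    and three: "\<And>v. v \<in> U \<Longrightarrow> card (cls U (f v)) = 3"
  shows "fresh_win U"
proof (cases "\<exists>v\<in>U. \<forall>u\<in>U. f u \<noteq> f v \<longrightarrow> adj u v")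
  case True
  then obtain v where v: "v \<in> U" "\<forall>u\<in>U. f u \<noteq> f v \<longrightarrow> adj u v" by blast
  have "card (U - cls U (f v)) = 3"
    using card_Diff_subset[of "cls U (f v)" U] fin three[OF v(1)] m by (simp add: cls_def)
  then show ?thesis
    by (intro fresh_win_by_exhausting[OF fin v(1) refl]) (use three[OF v(1)] v in \<open>auto simp: cls_def\<close>)
next
  case False
  show ?thesis
  proof (rule fresh_win_small_degree)
    fix v assume v: "v \<in> U"
    let ?R = "U - cls U (f v)"
    have R: "card ?R = 3"
      using card_Diff_subset[of "cls U (f v)" U] fin three[OF v] m by (simp add: cls_def)
    have "{w \<in> U. adj v w} \<subseteq> ?R" by (auto simp: cls_def dest: proper)
    moreover have "{w \<in> U. adj v w} \<noteq> ?R"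
      using False v adj_sym by (fastforce simp: cls_def)
    ultimately have "card {w \<in> U. adj v w} < 3"
      using psubset_card_mono[of ?R "{w \<in> U. adj v w}"] R fin by auto
    then show "card {w \<in> U. adj v w} + 2 < card (f ` U) + card U div 2"
      using fU m by simp
  qed
qed

lemma comfortable_witness:
  assumes "finite K" "K \<subseteq> L v" "card {w \<in> U. adj v w \<and> L w \<inter> K \<noteq> {}} < card K"
  shows "comfortable U L v"
  using assms unfolding comfortable_def by blast

lemma comfortable_small_degree:
  assumes "finite U" "finite K" "K \<subseteq> L v" "card {w \<in> U. adj v w} < card K"
  shows "comfortable U L v"
proof -
  have "card {w \<in> U. adj v w \<and> L w \<inter> K \<noteq> {}} \<le> card {w \<in> U. adj v w}"
    using assms(1) by (intro card_mono) auto
  then show ?thesis using assms unfolding comfortable_def by (meson le_less_trans)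
qed

text \<open>
  The cube with one vertex removed has this form: \<open>C\<close> is the smaller side of its bipartition and \<open>z\<close> the
  vertex of the larger side that sees all of \<open>C\<close>. There are three fresh colours, and once
  Maker has given \<open>a\<close> to \<open>z\<close>, every vertex has two unplayed neighbours; only the vertices of \<open>C\<close>, which
  may have lost \<open>a\<close>, are in danger. If Breaker plays \<open>g y\<close>, Maker gives \<open>y\<close> a further colour,
  which is thereby reserved for the rest of \<open>C\<close>. If Breaker plays \<open>y\<close>, Maker repeats \<open>a\<close> on \<open>g y\<close>, and
  every vertex left has one unplayed neighbour and at least two colours.
\<close>

lemma fresh_win_cube_minus_vertex:
  assumes fin: "finite C" and C: "card C = 3" and inj: "inj_on g C"
    and U: "U = insert z (C \<union> g ` C)" and z: "z \<notin> g ` C"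
    and col: "\<And>y. y \<in> C \<Longrightarrow> f y = i" "\<And>y. y \<in> C \<Longrightarrow> f (g y) = j" "f z = j" "i \<noteq> j"
    and ad: "\<And>y y'. y \<in> C \<Longrightarrow> y' \<in> C \<Longrightarrow> adj y (g y') \<longleftrightarrow> y \<noteq> y'"
  shows "fresh_win U"
  unfolding fresh_win_def
proof (intro allI impI)
  fix L F assume st: "stage U L F Map.empty" and count: "card (f ` U) + card U div 2 \<le> card F + 2"
  have finF: "finite F" using stage_finite(2)[OF st] .
  have disj: "C \<inter> g ` C = {}" using col by fastforce
  have zC: "z \<notin> C" using col by auto
  have gne: "g y \<noteq> y'" "y' \<noteq> g y" if "y \<in> C" "y' \<in> C" for y y'
    using col(1)[OF that(2)] col(2)[OF that(1)] col(4) by auto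
  have cU: "card U = 7"
    using U disj zC z fin C card_image[OF inj] by (simp add: card_Un_disjoint)
  have "C \<noteq> {}" using C by auto
  then have "f ` U = {i, j}" using col unfolding U by force
  then have F3: "3 \<le> card F" using count cU col(4) by simp
  then have "F \<noteq> {}" by auto
  then obtain a where a: "a \<in> F" by blast
  let ?L1 = "play z a L"
  have LF: "F \<subseteq> L w" if "w \<in> U" for w using stage_fresh_available[OF st that] by blast
  have U1: "U - {z} = C \<union> g ` C" using U zC z by blast
  have same: "\<not> adj u w" if "f u = f w" for u w using proper that by blast
  have L1C: "F - {a} \<subseteq> ?L1 y" if "y \<in> C" for y
    using LF[of y] that U by (auto simp: in_play)
  have L1g: "F \<subseteq> ?L1 (g y)" if "y \<in> C" for y
    using LF[of "g y"] that U same[of z "g y"] col by (auto simp: in_play)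
  have rem: "C \<union> g ` C - {y} - {g y} = (C - {y}) \<union> g ` (C - {y})" if "y \<in> C" for y
    using that disj inj by (auto simp: inj_on_def)
  have small: "card (C - {y} - {y'}) = 1" if "y \<in> C" "y' \<in> C" "y \<noteq> y'" for y y'
    using that fin C by simp
  have degC: "card {w \<in> (C - {y}) \<union> g ` (C - {y}). adj y' w} \<le> 1"
    if "y \<in> C" "y' \<in> C" "y \<noteq> y'" for y y'
  proof -
    have "{w \<in> (C - {y}) \<union> g ` (C - {y}). adj y' w} \<subseteq> g ` (C - {y} - {y'})"
      using that same[of y'] col ad by auto
    then have "card {w \<in> (C - {y}) \<union> g ` (C - {y}). adj y' w} \<le> card (g ` (C - {y} - {y'}))"
      using fin by (intro card_mono) auto
    also have "\<dots> \<le> 1" using card_image_le[of "C - {y} - {y'}" g] fin small[OF that] by simp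
    finally show ?thesis .
  qed
  have degg: "card {w \<in> (C - {y}) \<union> g ` (C - {y}). adj (g y') w} \<le> 1"
    if "y \<in> C" "y' \<in> C" "y \<noteq> y'" for y y'
  proof -
    have "{w \<in> (C - {y}) \<union> g ` (C - {y}). adj (g y') w} \<subseteq> C - {y} - {y'}"
      using that same[of "g y'"] col ad adj_sym by (auto; metis)
    then have "card {w \<in> (C - {y}) \<union> g ` (C - {y}). adj (g y') w} \<le> card (C - {y} - {y'})"
      using fin by (intro card_mono) auto
    then show ?thesis using small[OF that] by simp
  qed
  have big: "2 \<le> card (F - {c})" for c
    using F3 finF by (cases "c \<in> F") auto
  have replyC: "maker_wins (C \<union> g ` C - {y}) L2"
    if y: "y \<in> C" and L2: "\<And>w. w \<in> C \<Longrightarrow> F - {a} \<subseteq> L2 w" "a \<in> L2 (g y)"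
      "\<And>w. w \<in> C \<Longrightarrow> F - {c} \<subseteq> L2 (g w)" for y L2 c
  proof -
    let ?U3 = "(C - {y}) \<union> g ` (C - {y})" and ?L3 = "play (g y) a L2"
    have comfortable: "\<forall>w\<in>?U3. comfortable ?U3 ?L3 w"
    proof
      fix w assume "w \<in> ?U3"
      then consider "w \<in> C" "w \<noteq> y" | y' where "w = g y'" "y' \<in> C" "y' \<noteq> y" by blast
      then show "comfortable ?U3 ?L3 w"
      proof cases
        case 1
        show ?thesis
        proof (rule comfortable_small_degree[of _ "F - {a}"])
          show "F - {a} \<subseteq> ?L3 w" using L2(1)[OF 1(1)] by (auto simp: in_play)
          show "card {x \<in> ?U3. adj w x} < card (F - {a})" using degC[OF y 1(1) 1(2)[symmetric]] big[of a] by linarith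
        qed (use fin finF in auto)
      next
        case 2
        show ?thesis
        proof (rule comfortable_small_degree[of _ "F - {c}"])
          have "\<not> adj (g y) w" using same[of "g y" w] 2 y col by auto
          then show "F - {c} \<subseteq> ?L3 w" using L2(3)[OF 2(2)] 2 by (auto simp: in_play)
          show "card {x \<in> ?U3. adj w x} < card (F - {c})" using degg[OF y 2(2) 2(3)[symmetric]] 2(1) big[of c] by simp
        qed (use fin finF in auto)
      qed
    qed
    have "finite ?U3" using fin by simp
    then have bl: "breaker_loses ?U3 ?L3"
      using comfortable by (rule comfortable_wins[THEN conjunct2])
    have "g y \<in> C \<union> g ` C - {y}" using y gne[OF y y] by simp
    then show ?thesis
      by (rule maker_move[of "g y" _ a L2, OF _ L2(2)]) (use rem[OF y] bl in simp)
  qed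
  have replyg: "maker_wins (C \<union> g ` C - {g y}) L2"
    if y: "y \<in> C" and L2: "\<And>w. w \<in> C \<Longrightarrow> F - {a} - {c} \<subseteq> L2 w"
      "\<And>w. w \<in> C \<Longrightarrow> F \<subseteq> L2 (g w)" for y L2 c
  proof -
    have "F - {a} - {c} \<noteq> {}"
    proof
      assume "F - {a} - {c} = {}"
      then have "card (F - {a}) \<le> card {c}" by (intro card_mono) auto
      then show False using big[of a] by simp
    qed
    then obtain d where d: "d \<in> F - {a} - {c}" by blast
    let ?U3 = "(C - {y}) \<union> g ` (C - {y})" and ?L3 = "play y d L2"
    have comfortable: "\<forall>w\<in>?U3. comfortable ?U3 ?L3 w"
    proof
      fix w assume "w \<in> ?U3"
      then consider "w \<in> C" "w \<noteq> y" | y' where "w = g y'" "y' \<in> C" "y' \<noteq> y" by blast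
      then show "comfortable ?U3 ?L3 w"
      proof cases
        case 1
        have no: "{x \<in> ?U3. adj w x \<and> ?L3 x \<inter> {d} \<noteq> {}} = {}"
        proof -
          have "\<not> adj w x" if "x \<in> C" for x using same[of w x] 1 that col by auto
          moreover have "d \<notin> ?L3 (g x)" if "x \<in> C" "x \<noteq> y" for x
            using ad[OF y that(1)] that by (auto simp: in_play)
          ultimately show ?thesis by auto
        qed
        have "\<not> adj y w" using same[of y w] 1 y col by auto
        then have "{d} \<subseteq> ?L3 w" using L2(1)[OF 1(1)] d by (auto simp: in_play)
        moreover have "card {x \<in> ?U3. adj w x \<and> ?L3 x \<inter> {d} \<noteq> {}} < card {d}"
          unfolding no by simp
        ultimately show ?thesis by (rule comfortable_witness[OF finite.insertI[OF finite.emptyI]])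
      next
        case 2
        show ?thesis
        proof (rule comfortable_small_degree[of _ "F - {d}"])
          show "F - {d} \<subseteq> ?L3 w" using L2(2)[OF 2(2)] 2 by (auto simp: in_play)
          show "card {x \<in> ?U3. adj w x} < card (F - {d})" using degg[OF y 2(2) 2(3)[symmetric]] 2(1) big[of d] by simp
        qed (use fin finF in auto)
      qed
    qed
    have "finite ?U3" using fin by simp
    then have bl: "breaker_loses ?U3 ?L3"
      using comfortable by (rule comfortable_wins[THEN conjunct2])
    have "y \<in> C \<union> g ` C - {g y}" using y gne[OF y y] by simp
    moreover have "d \<in> L2 y" using L2(1)[OF y] d by blast
    moreover have "C \<union> g ` C - {g y} - {y} = ?U3" using rem[OF y] by blast
    then have "breaker_loses (C \<union> g ` C - {g y} - {y}) ?L3" using bl by simp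
    ultimately show ?thesis by (rule maker_move[of y _ d L2])
  qed
  have "breaker_loses (C \<union> g ` C) ?L1"
  proof (rule breaker_move)
    obtain y where "y \<in> C" using \<open>C \<noteq> {}\<close> by blast
    then show "\<exists>v\<in>C \<union> g ` C. ?L1 v \<noteq> {}" using L1g[of y] a by blast
  next
    fix u c assume "u \<in> C \<union> g ` C" "c \<in> ?L1 u"
    then consider "u \<in> C" | y where "y \<in> C" "u = g y" by blast
    then show "maker_wins (C \<union> g ` C - {u}) (play u c ?L1)"
    proof cases
      case 1
      show ?thesis
      proof (rule replyC[OF 1, of _ c])
        show "F - {a} \<subseteq> play u c ?L1 w" if "w \<in> C" for w
          using L1C[OF that] same[of u w] 1 that col(1) by (simp add: play_def)
        show "a \<in> play u c ?L1 (g u)"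
          using L1g[OF 1] a ad[OF 1 1] by (auto simp: play_def)
        show "F - {c} \<subseteq> play u c ?L1 (g w)" if "w \<in> C" for w
          using L1g[OF that] by (auto simp: in_play)
      qed
    next
      case 2
      show ?thesis unfolding 2(2)
      proof (rule replyg[OF 2(1), of c])
        show "F - {a} - {c} \<subseteq> play (g y) c ?L1 w" if "w \<in> C" for w
          using L1C[OF that] by (auto simp: in_play)
        show "F \<subseteq> play (g y) c ?L1 (g w)" if "w \<in> C" for w
          using L1g[OF that] same[of "g y" "g w"] 2 that col(2) by (simp add: play_def)
      qed
    qed
  next
    fix u assume "u \<in> C \<union> g ` C"
    then consider "u \<in> C" | y where "y \<in> C" "u = g y" by blast
    then show "maker_wins (C \<union> g ` C - {u}) ?L1"
    proof cases
      case 1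
      show ?thesis
        by (rule replyC[OF 1, of _ a]) (use L1C L1g[OF 1] a L1g in auto)
    next
      case 2
      show ?thesis unfolding 2(2)
        by (rule replyg[OF 2(1), of a]) (use L1C L1g in auto)
    qed
  qed
  then show "maker_wins U L"
    using maker_move[of z U a L] U1 LF[of z] a U by auto
qed

text \<open>
  If Maker starts in the class of three, Breaker must spoil it at once; otherwise Maker takes its last
  vertex. By the tempo argument, the spoiling vertex for \<open>v\<close> is adjacent to all of \<open>C\<close> but \<open>v\<close>, and
  \<open>v\<close> is adjacent to all of \<open>B\<close> but the spoiling vertex. If every \<open>v\<close> in \<open>C\<close> can be spoiled, this
  determines the graph.
\<close>

lemma fresh_win_three_four:
  assumes fin: "finite U" and v0: "v0 \<in> U" and C: "C = cls U (f v0)" "card C = 3"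
    and w0: "w0 \<in> U" and B: "B = cls U (f w0)" "card B = 4"
    and ij: "f v0 \<noteq> f w0" and U: "U = C \<union> B"
  shows "fresh_win U"
proof -
  have fC: "finite C" and fB: "finite B" using C B fin by (auto simp: cls_def)
  have colC: "\<And>y. y \<in> C \<Longrightarrow> f y = f v0" and colB: "\<And>x. x \<in> B \<Longrightarrow> f x = f w0"
    using C B by (auto simp: cls_def)
  have rest: "U - C = B" using U colC colB ij by fastforce
  define bad where "bad v u \<longleftrightarrow> u \<in> B \<and> \<not> adj u v \<and> (\<forall>w\<in>U - {v} - {u}. \<exists>x\<in>{u, v}. adj w x)"
    for v u
  show ?thesis
  proof (cases "\<exists>v\<in>C. \<forall>u. \<not> bad v u")
    case True
    then obtain v where v: "v \<in> C" "\<And>u. \<not> bad v u" by blast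
    have C': "C = cls U (f v)" using colC[OF v(1)] C by simp
    have vU: "v \<in> U" using v U by blast
    show ?thesis
    proof (rule fresh_win_by_exhausting[OF fin vU C'])
      fix A T u
      assume T: "v \<in> A" "A \<subseteq> T" "T \<subset> C" "card T + 1 = 2 * card A" and u: "u \<in> U - C"
        and na: "\<forall>x\<in>A. \<not> adj u x" and dom: "\<forall>w\<in>U - T - {u}. \<exists>x\<in>insert u A. adj w x"
      have "T = {v}" "A = {v}" using subset_of_triple[OF C(2) T] by auto
      then have "bad v u" using na dom u rest unfolding bad_def by simp
      then show "fresh_win (U - T - {u})" using v(2) by blast
    qed (use rest B C in auto)
  next
    case False
    then obtain g where g: "\<And>v. v \<in> C \<Longrightarrow> bad v (g v)" by metis
    have gB: "g v \<in> B" and ng: "\<not> adj (g v) v"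
      and dom: "\<And>w. w \<in> U - {v} - {g v} \<Longrightarrow> adj w (g v) \<or> adj w v" if "v \<in> C" for v
      using g[OF that] unfolding bad_def by auto
    have ad: "adj y (g y') \<longleftrightarrow> y \<noteq> y'" if "y \<in> C" "y' \<in> C" for y y'
    proof
      assume "adj y (g y')" then show "y \<noteq> y'" using ng[OF that(1)] adj_sym by blast
    next
      assume "y \<noteq> y'"
      moreover have "y \<noteq> g y'" using colC[OF that(1)] colB[OF gB[OF that(2)]] ij by auto
      moreover have "\<not> adj y y'" using colC that proper by metis
      ultimately show "adj y (g y')" using dom[OF that(2), of y] that U by auto
    qed
    have inj: "inj_on g C"
    proof (rule inj_onI)
      fix y y' assume "y \<in> C" "y' \<in> C" "g y = g y'"
      then show "y = y'" using ad[of y y'] ad[of y y] by auto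
    qed
    have "card (g ` C) = 3" using card_image[OF inj] C by simp
    moreover have gC: "g ` C \<subseteq> B" using gB by blast
    ultimately have "card (B - g ` C) = 1" using card_Diff_subset[of "g ` C" B] fC B by simp
    then obtain z where z: "B - g ` C = {z}" by (auto simp: card_1_singleton_iff)
    show ?thesis
    proof (rule fresh_win_cube_minus_vertex[OF fC C(2) inj, of U z "f v0" "f w0"])
      show "U = insert z (C \<union> g ` C)" using U z gC by blast
      show "z \<notin> g ` C" "f z = f w0" using z colB by auto
    qed (use colC colB gB ij ad in auto)
  qed
qed

section \<open>All positions except Turan graphs\<close>

definition turan_like :: "'a set \<Rightarrow> bool" where
  "turan_like U \<longleftrightarrow> (\<forall>v\<in>U. card (cls U (f v)) = 2 \<and> (\<forall>w\<in>U. f w \<noteq> f v \<longrightarrow> adj v w))"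

lemma turan_like_even:
  assumes "finite U" "turan_like U"
  shows "even (card U)"
proof (rule ccontr)
  assume "odd (card U)"
  then obtain i where i: "odd (card (cls U i))" using odd_cls_exists assms(1) by blast
  then obtain v where "v \<in> U" "f v = i" by (force simp: cls_def dest: odd_card_imp_not_empty)
  then show False using assms(2) i by (auto simp: turan_like_def)
qed

lemma card_ge_twice_classes:
  assumes "finite U" "\<And>v. v \<in> U \<Longrightarrow> 2 \<le> card (cls U (f v))"
  shows "2 * card (f ` U) \<le> card U"
proof -
  have "(\<Sum>i\<in>f ` U. 2) \<le> (\<Sum>i\<in>f ` U. card (cls U i))"
    by (rule sum_mono) (use assms(2) in auto)
  then show ?thesis using card_sum_cls[OF assms(1)] by simp
qed

text \<open>
  Maker exhausts the smaller class \<open>C\<close>. If this ends with the larger class alone, that class is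
  independent, and otherwise spoiling leaves a singleton class or at least six vertices, among them at
  least three of the larger class. This fails only for class sizes 3 and 4, and 3 and 3.
\<close>

lemma fresh_win_two_classes:
  assumes fin: "finite U" and m: "6 \<le> card U" and fU: "card (f ` U) = 2"
    and big: "\<And>v. v \<in> U \<Longrightarrow> 2 \<le> card (cls U (f v))"
    and IH: "\<And>U'. U' \<subset> U \<Longrightarrow> 6 \<le> card U' \<Longrightarrow> \<not> turan_like U' \<Longrightarrow> fresh_win U'"
  shows "fresh_win U"
proof -
  obtain p q where pq: "f ` U = {p, q}" "p \<noteq> q" "card (cls U p) \<le> card (cls U q)"
    using fU by (metis card_2_iff doubleton_eq_iff insert_commute linorder_linear)
  obtain v w where v: "v \<in> U" "f v = p" and w: "w \<in> U" "f w = q"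
    using pq(1) by (metis imageE insertI1 insert_commute)
  define C where "C = cls U p"
  define B where "B = cls U q"
  have two: "f x = p \<or> f x = q" if "x \<in> U" for x using pq(1) that by blast
  have U: "U = C \<union> B" using two by (auto simp: C_def B_def cls_def)
  have disj: "C \<inter> B = {}" using pq(2) by (auto simp: C_def B_def cls_def)
  have fC: "finite C" and fB: "finite B" using fin U by auto
  have rest: "U - C = B" using U disj by blast
  have cU: "card U = card C + card B" unfolding U using fC fB disj by (rule card_Un_disjoint)
  have C2: "2 \<le> card C" and le: "card C \<le> card B"
    using big[OF v(1)] v(2) pq(3) by (simp_all add: C_def B_def)
  have colB: "f x = q" if "x \<in> B" for x using that by (simp add: B_def cls_def)
  consider "4 \<le> card B" "even (card U) \<or> 5 \<le> card B" | "card C = 3" "card B = 4"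
    | "card C = 3" "card B = 3"
  proof -
    have "4 \<le> card B \<or> card C = 3 \<and> card B = 3" using m cU le by linarith
    moreover have "card C = 3" if "card B = 4" "odd (card U)"
    proof -
      have "odd (card C)" using that cU by simp
      moreover have "card C \<le> 4" using le that by simp
      ultimately show ?thesis using C2 by presburger
    qed
    ultimately show thesis using that by force
  qed
  then show ?thesis
  proof cases
    case 1
    show ?thesis
    proof (rule fresh_win_by_exhausting[OF fin v(1)])
      show "C = cls U (f v)" using v by (simp add: C_def)
    next
      have "f ` B = {q}" using colB w by (force simp: B_def cls_def)
      then show "fresh_win (U - C)" unfolding rest using fresh_win_one_class 1(1) by blast
    next
      fix A T :: "'a set" and u assume T: "T \<subset> C" "card T + 1 = 2 * card A" and u: "u \<in> U - C"
      let ?U' = "U - T - {u}"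
      have uB: "u \<in> B" using u rest by blast
      have fT: "finite T" using finite_subset[OF _ fC] T(1) by blast
      have split: "?U' = (C - T) \<union> (B - {u})" using U disj T(1) uB by blast
      have dj: "(C - T) \<inter> (B - {u}) = {}" using disj by blast
      have cCT: "card C = card T + card (C - T)" "1 \<le> card (C - T)"
      proof -
        show "card C = card T + card (C - T)"
          using card_Diff_subset[OF fT psubset_imp_subset[OF T(1)]]
            card_mono[OF fC psubset_imp_subset[OF T(1)]] by simp
        have "C - T \<noteq> {}" using T(1) by blast
        then show "1 \<le> card (C - T)" using fC by (simp add: Suc_le_eq card_gt_0_iff)
      qed
      have cBu: "card (B - {u}) = card B - 1" using uB by (rule card_Diff_singleton)
      have cU': "card ?U' = card (C - T) + card (B - {u})"
        unfolding split using fC fB dj by (intro card_Un_disjoint) auto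
      have clC: "cls ?U' p = C - T"
        using uB colB pq(2) by (auto simp: C_def cls_def)
      have clB: "cls ?U' q = B - {u}"
        using T(1) pq(2) by (auto simp: C_def B_def cls_def)
      obtain x where x: "x \<in> C - T" using T(1) by blast
      then have fx: "f x = p" "x \<in> U" by (auto simp: C_def cls_def)
      moreover have "x \<noteq> u" using fx colB[OF uB] pq(2) by auto
      ultimately have xU: "x \<in> ?U'" "f x = p" using x by auto
      show "fresh_win ?U'"
      proof (cases "card (C - T) = 1")
        case True
        then show ?thesis
          using fin cU' cBu 1(1) xU clC by (intro fresh_win_singleton[of _ x]) auto
      next
        case False
        have six: "6 \<le> card ?U'"
        proof (cases "5 \<le> card B")
          case True then show ?thesis using cU' cBu cCT(2) False by linarith
        next
          case F: False
          then have "even (card U)" using 1(2) by blast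
          moreover have "odd (card T)" using T(2) by presburger
          moreover have "card U = card ?U' + card T + 1" using cU cU' cBu cCT(1) 1(1) by linarith
          ultimately have "even (card ?U')" by simp
          moreover have "5 \<le> card ?U'" using cU' cBu cCT(2) False 1(1) by linarith
          ultimately show ?thesis by presburger
        qed
        have "card (B - {u}) \<noteq> 2" using cBu 1(1) by linarith
        moreover have "0 < card (B - {u})" using cBu 1(1) by linarith
        then have "B - {u} \<noteq> {}" by (metis card.empty less_irrefl)
        then obtain b where "b \<in> B - {u}" by blast
        then have "b \<in> ?U'" "f b = q" using split colB by auto
        ultimately have "\<not> turan_like ?U'" using clB unfolding turan_like_def by metis
        moreover have "?U' \<subset> U" using u by blast
        ultimately show ?thesis using IH[of ?U'] six by simp
      qed
    qed (use 1 rest fU in auto)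
  next
    case 2
    show ?thesis
    proof (rule fresh_win_three_four[OF fin v(1) _ 2(1) w(1) _ 2(2) _ U])
      show "C = cls U (f v)" using v by (simp add: C_def)
      show "B = cls U (f w)" using w by (simp add: B_def)
      show "f v \<noteq> f w" using v w pq(2) by simp
    qed
  next
    case 3
    show ?thesis
    proof (rule fresh_win_three_three[OF fin fU])
      show "card U = 6" using cU 3 by simp
      show "card (cls U (f x)) = 3" if "x \<in> U" for x
        using two[OF that] 3 by (auto simp: C_def B_def)
    qed
  qed
qed

text \<open>
  With at least three classes, what is left after spoiling has a singleton class or at least six
  vertices; so only Turan-like remainders matter. They have even order, so for odd order any odd class
  can be exhausted. If all classes are even and one has size at least four, Maker exhausts another one:
  the large class survives this, and spoiling leaves an odd class. If all classes have size two,
  \<open>fresh_win_pairs\<close> applies. For even order with odd classes, Maker exhausts an odd class of least size; then the remainder can be Turan-like only for class sizes 3, 3, 2, ..., 2.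
\<close>

lemma fresh_win_many_classes:
  assumes fin: "finite U" and m: "6 \<le> card U" and fU: "3 \<le> card (f ` U)"
    and big: "\<And>v. v \<in> U \<Longrightarrow> 2 \<le> card (cls U (f v))"
    and nt: "\<not> turan_like U"
    and IH: "\<And>U'. U' \<subset> U \<Longrightarrow> 6 \<le> card U' \<Longrightarrow> \<not> turan_like U' \<Longrightarrow> fresh_win U'"
  shows "fresh_win U"
proof -
  have rest: "4 \<le> card (U - cls U (f v))" if v: "v \<in> U" for v
  proof -
    let ?R = "U - cls U (f v)"
    have "f ` ?R = f ` U - {f v}" by (auto simp: cls_def)
    then have "2 \<le> card (f ` ?R)" using fU v by simp
    moreover have "cls ?R (f w) = cls U (f w)" if "w \<in> ?R" for w
      using that by (auto simp: cls_def)
    then have "2 * card (f ` ?R) \<le> card ?R"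
      using fin big by (intro card_ge_twice_classes) auto
    ultimately show ?thesis by linarith
  qed
  have spoil: "fresh_win (U - T - {u})"
    if v: "v \<in> U" and T: "T \<subset> cls U (f v)" and u: "u \<in> U - cls U (f v)"
      and n: "\<not> turan_like (U - T - {u})" for v T u
  proof -
    let ?U' = "U - T - {u}"
    let ?C = "cls U (f v)"
    have fC: "finite ?C" and CU: "?C \<subseteq> U" using fin by (auto simp: cls_def)
    obtain x where x: "x \<in> ?C - T" using T by blast
    have xU: "x \<in> ?U'" "f x = f v" using x u by (auto simp: cls_def)
    have "f ` U \<subseteq> f ` ?U'"
    proof
      fix k assume "k \<in> f ` U"
      then obtain y where y: "y \<in> U" "k = f y" by blast
      consider "f y = f v" | "f y = f u" "f y \<noteq> f v" | "f y \<noteq> f u" "f y \<noteq> f v" by blast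
      then show "k \<in> f ` ?U'"
      proof cases
        case 1 then show ?thesis using xU y by (metis imageI)
      next
        case 2
        have "\<not> cls U (f u) \<subseteq> {u}"
        proof
          assume "cls U (f u) \<subseteq> {u}"
          then have "card (cls U (f u)) \<le> card {u}" by (intro card_mono) auto
          then show False using big[of u] u by simp
        qed
        then obtain u' where "u' \<in> U" "f u' = f u" "u' \<noteq> u" by (auto simp: cls_def)
        moreover from this have "u' \<notin> T" using T 2 by (auto simp: cls_def)
        ultimately have "u' \<in> ?U'" by blast
        then show ?thesis using y 2 \<open>f u' = f u\<close> by (metis imageI)
      next
        case 3
        then have "y \<in> ?U'" using y T by (auto simp: cls_def)
        then show ?thesis using y by blast
      qed
    qed
    then have f3: "3 \<le> card (f ` ?U')" using fU card_mono[of "f ` ?U'" "f ` U"] fin by simp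
    have "insert x (U - ?C - {u}) \<subseteq> ?U'" using xU T by blast
    then have "card (insert x (U - ?C - {u})) \<le> card ?U'" using fin by (intro card_mono) auto
    moreover have "card (insert x (U - ?C - {u})) = card (U - ?C - {u}) + 1"
      using x fin by simp
    moreover have "card (U - ?C - {u}) = card (U - ?C) - 1" using u by (rule card_Diff_singleton)
    ultimately have c4: "4 \<le> card ?U'" using rest[OF v] by linarith
    show ?thesis
    proof (cases "\<exists>y\<in>?U'. card (cls ?U' (f y)) = 1")
      case True
      then show ?thesis using fresh_win_singleton[OF _ c4] fin by blast
    next
      case False
      have "2 \<le> card (cls ?U' (f y))" if y: "y \<in> ?U'" for y
        using cls_pos[of ?U' y] False that fin by force
      then have "2 * card (f ` ?U') \<le> card ?U'" using fin by (intro card_ge_twice_classes) auto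
      moreover have "?U' \<subset> U" using u by blast
      ultimately show ?thesis using IH n f3 by simp
    qed
  qed
  have oddT: "odd (card T)" if "card T + 1 = 2 * card A" for T :: "'a set" and A :: "'a set"
    using that by presburger
  have sub: "card (cls U (f v) - T) = card (cls U (f v)) - card T" if "T \<subset> cls U (f v)" for v T
    using card_Diff_subset[of T "cls U (f v)"] that fin
    by (meson finite_cls finite_subset psubset_imp_subset)
  consider (two) "\<And>v. v \<in> U \<Longrightarrow> card (cls U (f v)) = 2"
    | (odd) "odd (card U)"
    | (odd_class) v where "even (card U)" "v \<in> U" "odd (card (cls U (f v)))"
    | (even) w where "even (card U)" "\<And>v. v \<in> U \<Longrightarrow> even (card (cls U (f v)))"
        "w \<in> U" "card (cls U (f w)) \<noteq> 2"
    by blast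
  then show ?thesis
  proof cases
    case two
    then obtain x y where "x \<in> U" "y \<in> U" "f y \<noteq> f x" "\<not> adj x y"
      using nt unfolding turan_like_def by blast
    then show ?thesis
      by (intro fresh_win_pairs[OF fin m two, of x y]) (auto dest: adj_sym)
  next
    case odd
    obtain i where i: "odd (card (cls U i))" using odd_cls_exists[OF fin odd] by blast
    then obtain v where v: "v \<in> U" "f v = i" by (force simp: cls_def dest: odd_card_imp_not_empty)
    show ?thesis
    proof (rule fresh_win_by_exhausting[OF fin v(1) refl])
      fix A T :: "'a set" and u assume T: "T \<subset> cls U (f v)" "card T + 1 = 2 * card A" and u: "u \<in> U - cls U (f v)"
      have TU: "T \<subseteq> U" using T(1) by (auto simp: cls_def)
      have "u \<in> U - T" using u T(1) by blast
      then have "card (U - T - {u}) + 1 = card (U - T)"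
        using fin by (metis Suc_eq_plus1 card_Suc_Diff1 finite_Diff)
      moreover have "card (U - T) + card T = card U"
        using card_Diff_subset[OF finite_subset[OF TU fin] TU] card_mono[OF fin TU] by simp
      ultimately have "odd (card (U - T - {u}) + 1 + card T)" using odd by simp
      then have "odd (card (U - T - {u}))" using oddT[OF T(2)] by simp
      then have "\<not> turan_like (U - T - {u})" using turan_like_even[of "U - T - {u}"] fin by auto
      then show "fresh_win (U - T - {u})" using spoil[OF v(1) T(1) u] by blast
    qed (use i v rest[OF v(1)] in auto)
  next
    case (odd_class v')
    obtain v0 where v0: "v0 \<in> U" "odd (card (cls U (f v0)))"
      and least: "\<And>w. w \<in> U \<Longrightarrow> odd (card (cls U (f w))) \<Longrightarrow>
        card (cls U (f v0)) \<le> card (cls U (f w))"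
      using ex_has_least_nat[of "\<lambda>w. w \<in> U \<and> odd (card (cls U (f w)))" v'
          "\<lambda>w. card (cls U (f w))"] odd_class by auto
    define C where "C = cls U (f v0)"
    define D where "D = {u \<in> U. f u \<noteq> f v0 \<and> card (cls U (f u)) = 3}"
    \<comment> \<open>If possible, start at a vertex that sees all other classes of size three. Should there be none,
      any start will do: for class sizes 3, 3, 2, ..., 2, a Turan-like remainder would make the other
      vertices of \<open>C\<close> see all of \<open>D\<close>, the spoiling vertex included, as all vertices left see the
      spoiled colour.\<close>
    have "\<exists>v\<in>C. (\<forall>u\<in>D. adj u v) \<or> \<not> (\<exists>x\<in>C. \<forall>u\<in>D. adj u x)"
    proof (cases "\<exists>x\<in>C. \<forall>u\<in>D. adj u x")
      case False
      moreover have "v0 \<in> C" using v0 by (simp add: C_def cls_def)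
      ultimately show ?thesis by blast
    qed blast
    then obtain v where v: "v \<in> C" "(\<forall>u\<in>D. adj u v) \<or> \<not> (\<exists>x\<in>C. \<forall>u\<in>D. adj u x)" by blast
    have vU: "v \<in> U" "f v = f v0" using v(1) by (auto simp: C_def cls_def)
    have Cv: "C = cls U (f v)" using vU by (simp add: C_def)
    show ?thesis
    proof (rule fresh_win_by_exhausting[OF fin vU(1) Cv])
      fix A T :: "'a set" and u
      assume T: "v \<in> A" "A \<subseteq> T" "T \<subset> C" "card T + 1 = 2 * card A" and u: "u \<in> U - C"
        and na: "\<forall>x\<in>A. \<not> adj u x" and dom: "\<forall>w\<in>U - T - {u}. \<exists>x\<in>insert u A. adj w x"
      have T': "T \<subset> cls U (f v)" and u': "u \<in> U - cls U (f v)" using T u Cv by auto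
      have fu: "f u \<noteq> f v0" using u by (simp add: C_def cls_def)
      have "\<not> turan_like (U - T - {u})"
      proof
        assume tl: "turan_like (U - T - {u})"
        have clu: "cls (U - T - {u}) (f u) = cls U (f u) - {u}"
          using T(3) fu by (auto simp: C_def cls_def)
        have "u \<in> cls U (f u)" using u by (simp add: cls_def)
        then have "card (cls U (f u) - {u}) = card (cls U (f u)) - 1" by (rule card_Diff_singleton)
        moreover from this have "0 < card (cls U (f u) - {u})" using big[of u] u by simp
        then have "cls U (f u) - {u} \<noteq> {}" by (metis card.empty less_irrefl)
        then obtain u2 where "u2 \<in> cls U (f u) - {u}" by blast
        then have "u2 \<in> U - T - {u}" "f u2 = f u"
          using T(3) fu by (auto simp: C_def cls_def)
        then have "card (cls (U - T - {u}) (f u)) = 2" using tl unfolding turan_like_def by metis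
        ultimately have c3: "card (cls U (f u)) = 3" using clu by simp
        then have uD: "u \<in> D" using u fu by (simp add: D_def)
        have "card C \<le> 3" using least[of u] c3 u by (simp add: C_def)
        moreover have "odd (card C)" "2 \<le> card C" using v0 big[OF v0(1)] by (simp_all add: C_def)
        ultimately have "card C = 3" by presburger
        from subset_of_triple[OF this T] have TA: "T = {v}" "A = {v}" by auto
        have "\<not> adj u v" using na TA by simp
        then have no: "\<not> (\<exists>x\<in>C. \<forall>u\<in>D. adj u x)" using v(2) uD by blast
        obtain x where x: "x \<in> C - T" using T(3) by blast
        have xU: "x \<in> U - T - {u}" "f x = f v0" using x fu by (auto simp: C_def cls_def)
        have "adj u' x" if u': "u' \<in> D" for u'
        proof (cases "u' = u")
          case True
          have "adj x u \<or> adj x v" using dom xU(1) TA by simp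
          moreover have "\<not> adj x v" using proper[of x v] xU vU by auto
          ultimately show ?thesis using True adj_sym by blast
        next
          case False
          then have "u' \<in> U - T - {u}" "f u' \<noteq> f x" using u' TA vU xU by (auto simp: D_def)
          then show ?thesis using tl xU(1) unfolding turan_like_def by metis
        qed
        then show False using no x by blast
      qed
      then show "fresh_win (U - T - {u})" using spoil[OF vU(1) T' u'] by blast
    qed (use v0 Cv rest[OF vU(1)] odd_class in \<open>auto simp: C_def\<close>)
  next
    case (even w)
    have "\<not> f ` U \<subseteq> {f w}"
    proof
      assume "f ` U \<subseteq> {f w}"
      then have "card (f ` U) \<le> card {f w}" by (intro card_mono) auto
      then show False using fU by simp
    qed
    then obtain v where v: "v \<in> U" "f v \<noteq> f w" by auto
    show ?thesis
    proof (rule fresh_win_by_exhausting[OF fin v(1) refl])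
      let ?R = "U - cls U (f v)"
      have clR: "cls ?R (f x) = cls U (f x)" if "x \<in> ?R" for x
        using that by (auto simp: cls_def)
      have wR: "w \<in> ?R" using v even by (simp add: cls_def)
      then have "\<not> turan_like ?R" using clR even(4) by (auto simp: turan_like_def)
      moreover have "?R \<subset> U" using v by (auto simp: cls_def)
      moreover have "6 \<le> card ?R"
      proof -
        have "\<not> f ` U \<subseteq> {f v, f w}"
        proof
          assume "f ` U \<subseteq> {f v, f w}"
          then have "card (f ` U) \<le> card {f v, f w}" by (intro card_mono) auto
          also have "\<dots> \<le> 2" by (simp add: card_insert_if)
          finally show False using fU by simp
        qed
        then obtain y where y: "y \<in> U" "f y \<noteq> f v" "f y \<noteq> f w" by auto
        have "cls U (f w) \<union> cls U (f y) \<subseteq> ?R" using v y by (auto simp: cls_def)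
        then have "card (cls U (f w) \<union> cls U (f y)) \<le> card ?R" using fin by (intro card_mono) auto
        moreover have "card (cls U (f w) \<union> cls U (f y)) = card (cls U (f w)) + card (cls U (f y))"
          using fin y by (intro card_Un_disjoint finite_cls) (auto simp: cls_def)
        moreover have "4 \<le> card (cls U (f w))"
          using big[OF even(3)] even(2)[OF even(3)] even(4) by (auto elim!: evenE)
        ultimately show ?thesis using big[OF y(1)] by linarith
      qed
      ultimately show "fresh_win ?R" using IH by blast
    next
      fix A T :: "'a set" and u assume T: "T \<subset> cls U (f v)" "card T + 1 = 2 * card A" and u: "u \<in> U - cls U (f v)"
      have "\<not> turan_like (U - T - {u})"
      proof
        assume tl: "turan_like (U - T - {u})"
        obtain x where x: "x \<in> cls U (f v) - T" using T(1) by blast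
        then have "x \<in> U - T - {u}" "f x = f v" using u by (auto simp: cls_def)
        then have "card (cls (U - T - {u}) (f v)) = 2" using tl unfolding turan_like_def by metis
        moreover have "cls (U - T - {u}) (f v) = cls U (f v) - T" using u by (auto simp: cls_def)
        ultimately have "card (cls U (f v)) - card T = 2" using sub[OF T(1)] by simp
        then have "card (cls U (f v)) = card T + 2" by simp
        then show False using even(2)[OF v(1)] oddT[OF T(2)] by simp
      qed
      then show "fresh_win (U - T - {u})" using spoil[OF v(1) T(1) u] by blast
    qed (use even rest[OF v(1)] in auto)
  qed
qed

theorem fresh_win_unless_turan:
  assumes "finite U" "6 \<le> card U" "\<not> turan_like U"
  shows "fresh_win U"
  using assms
proof (induction "card U" arbitrary: U rule: less_induct)
  case less
  have fin: "finite U" and m: "6 \<le> card U" by fact+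
  have IH: "fresh_win U'" if "U' \<subset> U" "6 \<le> card U'" "\<not> turan_like U'" for U'
    using less.hyps[of U'] psubset_card_mono[OF fin that(1)] that finite_subset[of U' U] fin by blast
  have "U \<noteq> {}" using m by auto
  then have "0 < card (f ` U)" using fin by (simp add: card_gt_0_iff)
  show ?case
  proof (cases "\<exists>v\<in>U. card (cls U (f v)) = 1")
    case True
    then show ?thesis using fresh_win_singleton fin m by force
  next
    case False
    have big: "2 \<le> card (cls U (f v))" if "v \<in> U" for v
      using cls_pos[OF fin that] False that by force
    consider "card (f ` U) = 1" | "card (f ` U) = 2" | "3 \<le> card (f ` U)"
      using \<open>0 < card (f ` U)\<close> by linarith
    then show ?thesis
    proof cases
      case 1
      then obtain i where "f ` U = {i}" by (auto simp: card_1_singleton_iff)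
      then show ?thesis using fresh_win_one_class m by simp
    next
      case 2
      show ?thesis by (rule fresh_win_two_classes[OF fin m 2 big IH])
    next
      case 3
      show ?thesis by (rule fresh_win_many_classes[OF fin m 3 big less.prems(3) IH])
    qed
  qed
qed

end

section \<open>From positions to histories\<close>

definition avail :: "'a pair_pre_digraph \<Rightarrow> nat \<Rightarrow> 'a history \<Rightarrow> 'a \<Rightarrow> nat set" where
  "avail G k h v = {c. c < k \<and> (\<forall>u. (v, u) \<in> parcs G \<longrightarrow> map_of h u \<noteq> Some (Colour c))}"

lemma legal_colour_iff: "legal_colour G k h v c \<longleftrightarrow> v \<in> unplayed G h \<and> c \<in> avail G k h v"
  by (simp add: legal_colour_def avail_def)

lemma unplayed_Cons: "unplayed G ((v, m) # h) = unplayed G h - {v}"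
  by (auto simp: unplayed_def)

lemma avail_Blank: "v \<in> unplayed G h \<Longrightarrow> avail G k ((v, Blank) # h) = avail G k h"
  by (auto simp: avail_def unplayed_def fun_eq_iff) (metis option.distinct(1))

context coloured_graph
begin

lemma avail_Colour:
  assumes "\<And>u v. adj u v \<longleftrightarrow> (u, v) \<in> parcs G" "v \<in> unplayed G h"
  shows "avail G k ((v, Colour c) # h) = play v c (avail G k h)"
  using assms adj_sym by (auto simp: avail_def unplayed_def play_def fun_eq_iff)

text \<open>
  Maker's strategy chooses any move after which the list game is still won.
\<close>

lemma winning_strategy_exists:
  assumes adj: "\<And>u v. adj u v \<longleftrightarrow> (u, v) \<in> parcs G"
    and win: "maker_wins (pverts G) (\<lambda>_. {..<k})"
  shows "\<exists>\<sigma>. winning_strategy G k \<sigma>"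
proof -
  let ?U = "unplayed G" and ?L = "avail G k"
  define good where "good h v c \<longleftrightarrow>
      legal_colour G k h v c \<and> breaker_loses (?U h - {v}) (play v c (?L h))" for h v c
  define \<sigma> where "\<sigma> h = (SOME (v, c). good h v c)" for h
  have over: "game_over G k h \<longleftrightarrow> (\<forall>v\<in>?U h. ?L h v = {})" for h
    by (auto simp: game_over_def legal_colour_iff)
  have choice: "good h (fst (\<sigma> h)) (snd (\<sigma> h))"
    if "maker_wins (?U h) (?L h)" "?U h \<noteq> {}" for h
  proof -
    have "\<exists>v c. good h v c"
      using that(1)
    proof cases
      case (maker_move v c)
      then show ?thesis by (auto simp: good_def legal_colour_iff)
    qed (use that(2) in simp)
    then have "\<exists>p. case p of (v, c) \<Rightarrow> good h v c" by auto
    from someI_ex[OF this] show ?thesis unfolding \<sigma>_def by (simp add: case_prod_unfold)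
  qed
  have inv: "if even (length h) then maker_wins (?U h) (?L h) else breaker_loses (?U h) (?L h)"
    if "h \<in> plays G k \<sigma>" for h
    using that
  proof induction
    case start
    have "?U [] = pverts G" "?L [] = (\<lambda>_. {..<k})" by (auto simp: unplayed_def avail_def)
    then show ?case using win by simp
  next
    case (maker h v c)
    have v: "v \<in> ?U h" using maker(4) by (simp add: legal_colour_iff)
    then have "good h (fst (\<sigma> h)) (snd (\<sigma> h))" using choice[of h] maker by auto
    then show ?case
      using maker(2,3) by (simp add: good_def unplayed_Cons avail_Colour[OF adj v])
  next
    case (breaker_colour h v c)
    have v: "v \<in> ?U h" and c: "c \<in> ?L h v" using breaker_colour(3) by (auto simp: legal_colour_iff)
    have "breaker_loses (?U h) (?L h)" using breaker_colour by simp
    then have "maker_wins (?U h - {v}) (play v c (?L h))"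
      by cases (use v c in auto)
    then show ?case
      using breaker_colour(2) by (simp add: unplayed_Cons avail_Colour[OF adj v])
  next
    case (breaker_blank h v)
    have "breaker_loses (?U h) (?L h)" using breaker_blank by simp
    then have "maker_wins (?U h - {v}) (?L h)"
      by cases (use breaker_blank(4) in auto)
    then show ?case
      using breaker_blank(2,4) by (simp add: unplayed_Cons avail_Blank)
  qed
  have "winning_strategy G k \<sigma>"
    unfolding winning_strategy_def
  proof (intro ballI conjI impI)
    fix h assume h: "h \<in> plays G k \<sigma>" and e: "even (length h) \<and> \<not> game_over G k h"
    then have "maker_wins (?U h) (?L h)" using inv[OF h] by simp
    moreover have "?U h \<noteq> {}" using e over by auto
    ultimately show "legal_colour G k h (fst (\<sigma> h)) (snd (\<sigma> h))"
      using choice by (simp add: good_def)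
  next
    fix h assume h: "h \<in> plays G k \<sigma>" and g: "game_over G k h"
    show "?U h = {}"
    proof (rule ccontr)
      assume ne: "?U h \<noteq> {}"
      show False
      proof (cases "even (length h)")
        case True
        then have "good h (fst (\<sigma> h)) (snd (\<sigma> h))" using choice ne inv[OF h] by simp
        then show False using g by (auto simp: good_def game_over_def)
      next
        case False
        then have "breaker_loses (?U h) (?L h)" using inv[OF h] by simp
        then show False by cases (use ne g over in auto)
      qed
    qed
  qed
  then show ?thesis by blast
qed

lemma chi_gb_le:
  assumes adj: "\<And>u v. adj u v \<longleftrightarrow> (u, v) \<in> parcs G"
    and fin: "finite (pverts G)" and m: "6 \<le> card (pverts G)" and nt: "\<not> turan_like (pverts G)"
    and col: "f ` pverts G \<subseteq> {..<c}"
  shows "chi_gb G \<le> c + card (pverts G) div 2 - 2"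
proof -
  let ?k = "c + card (pverts G) div 2 - 2"
  have "card (f ` pverts G) \<le> c" using card_mono[OF _ col] by simp
  then have "maker_wins (pverts G) (\<lambda>_. {..<?k})"
    using fresh_win_unless_turan[OF fin m nt] fin m
    unfolding fresh_win_def stage_def by (elim allE[of _ "\<lambda>_. {..<?k}"] allE[of _ "{..<?k}"]) auto
  then show ?thesis
    unfolding chi_gb_def using winning_strategy_exists[OF adj] by (blast intro: Least_le)
qed

text \<open>
  In \<open>T(2r,r)\<close>, the first coordinate numbers the classes, and the second one tells whether a
  vertex is the chosen representative of its class.
\<close>

lemma turan_like_iso:
  assumes wf: "wf_digraph (with_proj G)" and adj: "\<And>u v. adj u v \<longleftrightarrow> (u, v) \<in> parcs G"
    and fin: "finite (pverts G)" and tl: "turan_like (pverts G)"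
  shows "\<exists>r. digraph_iso (with_proj G) (with_proj (turan_2r r))"
proof -
  let ?V = "pverts G"
  define r where "r = card (f ` ?V)"
  obtain h where h: "bij_betw h (f ` ?V) {0..<r}"
    unfolding r_def using ex_bij_betw_finite_nat fin by blast
  have hinj: "h i = h j \<longleftrightarrow> i = j" if "i \<in> f ` ?V" "j \<in> f ` ?V" for i j
    using h that by (meson bij_betw_imp_inj_on inj_on_eq_iff)
  define rep where "rep i = (SOME v. v \<in> cls ?V i)" for i
  have pair: "\<exists>w. w \<noteq> rep (f v) \<and> cls ?V (f v) = {rep (f v), w}" if "v \<in> ?V" for v
  proof -
    have two: "card (cls ?V (f v)) = 2" using tl that by (simp add: turan_like_def)
    then have "cls ?V (f v) \<noteq> {}" by auto
    then have "rep (f v) \<in> cls ?V (f v)" unfolding rep_def by (rule some_in_eq[THEN iffD2])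
    with two show ?thesis by (metis card_2_iff doubleton_eq_iff insertE singletonD)
  qed
  define \<phi> where "\<phi> v = (h (f v), v = rep (f v))" for v
  have inj: "inj_on \<phi> ?V"
  proof (rule inj_onI)
    fix u v assume uv: "u \<in> ?V" "v \<in> ?V" "\<phi> u = \<phi> v"
    then have fe: "f u = f v" using hinj by (auto simp: \<phi>_def)
    obtain w where w: "w \<noteq> rep (f v)" "cls ?V (f v) = {rep (f v), w}" using pair[OF uv(2)] by blast
    have "u \<in> cls ?V (f v)" "v \<in> cls ?V (f v)" using uv fe by (auto simp: cls_def)
    then show "u = v" using w uv(3) fe by (auto simp: \<phi>_def)
  qed
  have img: "\<phi> ` ?V = {..<r} \<times> UNIV"
  proof
    show "\<phi> ` ?V \<subseteq> {..<r} \<times> UNIV" using bij_betw_imp_surj_on[OF h] by (auto simp: \<phi>_def)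
    show "{..<r} \<times> UNIV \<subseteq> \<phi> ` ?V"
    proof (clarify)
      fix i :: nat and b :: bool assume "i < r"
      then have "i \<in> h ` f ` ?V" using bij_betw_imp_surj_on[OF h] by simp
      then obtain v where v: "v \<in> ?V" "i = h (f v)" by blast
      obtain w where w: "w \<noteq> rep (f v)" "cls ?V (f v) = {rep (f v), w}" using pair[OF v(1)] by blast
      define x where "x = (if b then rep (f v) else w)"
      have "x \<in> cls ?V (f v)" using w by (simp add: x_def)
      then have "x \<in> ?V" "f x = f v" by (auto simp: cls_def)
      moreover from this have "\<phi> x = (i, b)" using v w by (auto simp: \<phi>_def x_def)
      ultimately show "(i, b) \<in> \<phi> ` ?V" by (metis imageI)
    qed
  qed
  have verts: "u \<in> ?V" "v \<in> ?V" if "(u, v) \<in> parcs G" for u v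
    using wf_digraph.tail_in_verts[OF wf, of "(u, v)"] wf_digraph.head_in_verts[OF wf, of "(u, v)"]
      that by auto
  have arcs: "(u, v) \<in> parcs G \<longleftrightarrow> fst (\<phi> u) \<noteq> fst (\<phi> v)" if "u \<in> ?V" "v \<in> ?V" for u v
    using that tl proper[of u v] hinj[of "f u" "f v"] adj unfolding turan_like_def \<phi>_def by auto
  let ?hom = "\<lparr> iso_verts = \<phi>, iso_arcs = map_prod \<phi> \<phi>, iso_head = snd, iso_tail = fst \<rparr>"
  have "pre_digraph.digraph_isomorphism (with_proj G) ?hom"
    unfolding pre_digraph.digraph_isomorphism_def
    using wf inj verts by (auto simp: inj_on_def)
  moreover have "map_prod \<phi> \<phi> ` parcs G =
      {(u, v). u \<in> {..<r} \<times> UNIV \<and> v \<in> {..<r} \<times> UNIV \<and> fst u \<noteq> fst v}"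
  proof (intro set_eqI iffI)
    fix e assume "e \<in> map_prod \<phi> \<phi> ` parcs G"
    then obtain u v where "(u, v) \<in> parcs G" "e = (\<phi> u, \<phi> v)" by auto
    then show "e \<in> {(u, v). u \<in> {..<r} \<times> UNIV \<and> v \<in> {..<r} \<times> UNIV \<and> fst u \<noteq> fst v}"
      using verts arcs img by blast
  next
    fix e :: "(nat \<times> bool) \<times> (nat \<times> bool)"
    assume "e \<in> {(u, v). u \<in> {..<r} \<times> UNIV \<and> v \<in> {..<r} \<times> UNIV \<and> fst u \<noteq> fst v}"
    then obtain a b where ab: "e = (a, b)" "a \<in> \<phi> ` ?V" "b \<in> \<phi> ` ?V" "fst a \<noteq> fst b"
      unfolding img by auto
    then obtain u v where "u \<in> ?V" "v \<in> ?V" "a = \<phi> u" "b = \<phi> v" by blast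
    moreover from this have "(u, v) \<in> parcs G" using arcs ab(4) by blast
    ultimately show "e \<in> map_prod \<phi> \<phi> ` parcs G" using ab(1) by force
  qed
  then have "with_proj (turan_2r r) = app_iso ?hom (with_proj G)"
    by (simp add: app_iso_def with_proj_def turan_2r_def img)
  ultimately show ?thesis unfolding digraph_iso_def by blast
qed

end

theorem theorem1p3:
  fixes G :: "'a pair_pre_digraph"
  assumes "pair_graph G"
    and "card (pverts G) \<ge> 6"
    and "\<forall>r. \<not> digraph_iso (with_proj G) (with_proj (turan_2r r))"
  shows "int (chi_gb G) - int (chromatic_number G) \<le> \<lfloor>real (card (pverts G)) / 2\<rfloor> - 2"
proof -
  interpret G: pair_graph G by fact
  have fin: "finite (pverts G)" by (rule G.pair_finite_verts)
  obtain g :: "'a \<Rightarrow> nat" where g: "bij_betw g (pverts G) {0..<card (pverts G)}"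
    using ex_bij_betw_finite_nat[OF fin] by blast
  have "proper_colouring G (card (pverts G)) g"
    unfolding proper_colouring_def
  proof (intro conjI ballI)
    show "g v < card (pverts G)" if "v \<in> pverts G" for v
      using bij_betwE[OF g] that by simp
  next
    fix e assume e: "e \<in> parcs G"
    obtain u v where uv: "e = (u, v)" by (cases e)
    have "u \<in> pverts G" "v \<in> pverts G" "u \<noteq> v"
      using G.arc_fst_in_verts[OF e] G.arc_snd_in_verts[OF e] G.pair_no_loops[OF e] uv by auto
    then have "g u \<noteq> g v" using inj_onD[OF bij_betw_imp_inj_on[OF g]] by blast
    then show "case e of (u, v) \<Rightarrow> g u \<noteq> g v" using uv by simp
  qed
  then have "\<exists>k f. proper_colouring G k f" by blast
  from LeastI_ex[OF this] obtain f where f: "proper_colouring G (chromatic_number G) f"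
    unfolding chromatic_number_def by blast
  interpret coloured_graph "\<lambda>u v. (u, v) \<in> parcs G" f
  proof
    show "(v, u) \<in> parcs G" if "(u, v) \<in> parcs G" for u v
      using G.pair_sym_arcs that by (auto simp: symmetric_def dest: symD)
    show "f u \<noteq> f v" if "(u, v) \<in> parcs G" for u v
      using f that by (auto simp: proper_colouring_def)
  qed
  have wf: "wf_digraph (with_proj G)" by unfold_locales
  have "\<not> turan_like (pverts G)" using turan_like_iso[OF wf refl fin] assms(3) by blast
  moreover have "f ` pverts G \<subseteq> {..<chromatic_number G}"
    using f by (auto simp: proper_colouring_def)
  ultimately have "chi_gb G \<le> chromatic_number G + card (pverts G) div 2 - 2"
    by (intro chi_gb_le[OF refl fin assms(2)])
  moreover have "\<lfloor>real (card (pverts G)) / 2\<rfloor> = int (card (pverts G) div 2)"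
    using floor_divide_of_nat_eq[of "card (pverts G)" 2] by simp
  moreover have "3 \<le> card (pverts G) div 2" using assms(2) by simp
  ultimately show ?thesis by linarith
qed

end
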